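(* Let $S$ and $W$ be compact manifolds and let $\pi:M\to\overline{M}$ be a multi-fiber bundle with fibers $(S,W)$ and multi-fiber atlas $(\overline{U}_\alpha,\phi_\alpha)_{\alpha\in A}$, $\phi_\alpha=(\pi,h_\alpha,f_\alpha)$. Let $H\subset\mathrm{Diff}(S)$ be the subgroup generated by all the diffeomorphisms $h_{\alpha\beta}(p)=h_\alpha|_{S_p}\circ(h_\beta|_{S_p})^{-1}$, for $\alpha,\beta\in A$ and $p\in\pi^{-1}(\overline{U}_\alpha\cap\overline{U}_\beta)$. Let $X$ be a vector field on $S$ that is $H$-invariant, i.e. $T_xh(X(x))=X(h(x))$ for all $h\in H$ and $x\in S$. Then setting $$\tilde X(p):=\big(T_p(h_\alpha|_{S_p})\big)^{-1}\big(X(h_\alpha(p))\big)\in T_pS_p\subset T_pM$$ for any $\alpha\in A$ with $p\in\pi^{-1}(\overline{U}_\alpha)$ gives a well-defined (independent of the choice of $\alpha$) vector field $\tilde X$ on $M$.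
   Context: Multi-fiber bundle: let $S,W$ be compact manifolds and let $\pi:M\to\overline{M}$ be a smooth fiber bundle with fiber $S\times W$. A bundle chart is a pair $(\overline{U},\phi)$ with $\overline{U}\subset\overline{M}$ open and $\phi:\pi^{-1}(\overline{U})\to\overline{U}\times S\times W$ a diffeomorphism whose first component is $\pi$; write $\phi=(\pi,h,f)$ with $h:\pi^{-1}(\overline{U})\to S$ and $f:\pi^{-1}(\overline{U})\to W$. A bundle atlas is a family of bundle charts whose domains $\overline{U}$ cover $\overline{M}$. A bundle atlas $(\overline{U}_\alpha,\phi_\alpha)_{\alpha\in A}$, $\phi_\alpha=(\pi,h_\alpha,f_\alpha)$, is called an $(S,W)$-multi-fiber atlas if for all $\alpha,\beta\in A$ with $\overline{U}_\alpha\cap\overline{U}_\beta\neq\emptyset$ and all $p\in\pi^{-1}(\overline{U}_\alpha\cap\overline{U}_\beta)$: (i) $\phi_\alpha^{-1}(\{\pi(p)\}\times S\times\{f_\alpha(p)\})=\phi_\beta^{-1}(\{\pi(p)\}\times S\times\{f_\beta(p)\})$; (ii) $\phi_\alpha^{-1}(\{\pi(p)\}\times\{h_\alpha(p)\}\times W)=\phi_\beta^{-1}(\{\pi(p)\}\times\{h_\beta(p)\}\times W)$. The bundle is a multi-fiber bundle with fibers $(S,W)$ if it admits such an atlas. The $S$-fiber at $p\in M$ is $S_p:=\phi_\alpha^{-1}(\{\pi(p)\}\times S\times\{f_\alpha(p)\})$ for any $\alpha$ with $\pi(p)\in\overline{U}_\alpha$ (independent of $\alpha$ by (i)); it is a submanifold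 of $M$ and the restriction $h_\alpha|_{S_p}:S_p\to S$ is a diffeomorphism. $T_pf$ denotes the tangent map of $f$ at $p$. Vector fields are smooth. *)

theory Defs
  imports "HOL-Analysis.Analysis" "HOL-Algebra.Generated_Groups" "HOL-Algebra.Bij"
begin

section \<open>Smooth maps between normed spaces\<close>

text \<open>Used for open \<open>U\<close> and finite-dimensional spaces only; there, directional continuity of all
  iterated derivatives is the usual notion of class \<open>C\<^sup>k\<close>.\<close>

primrec Ck_on ::
    "nat \<Rightarrow> 'a::real_normed_vector set \<Rightarrow> ('a \<Rightarrow> 'b::real_normed_vector) \<Rightarrow> bool" where
  "Ck_on 0 U f \<longleftrightarrow> continuous_on U f"
| "Ck_on (Suc k) U f \<longleftrightarrow>
     (\<forall>x\<in>U. f differentiable (at x)) \<and> (\<forall>v. Ck_on k U (\<lambda>x. frechet_derivative f (at x) v))"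

definition smooth_on ::
    "'a::real_normed_vector set \<Rightarrow> ('a \<Rightarrow> 'b::real_normed_vector) \<Rightarrow> bool" where
  "smooth_on U f \<longleftrightarrow> (\<forall>k. Ck_on k U f)"

section \<open>Smooth manifolds\<close>

text \<open>The model space is a finite-dimensional real inner product space \<open>'e\<close>. The class
  \<open>euclidean_space\<close> is not used because it excludes dimension \<open>0\<close>.
  Only the values of a chart map on its domain matter.\<close>

type_synonym ('a, 'e) chart = "'a set \<times> ('a \<Rightarrow> 'e)"

record ('a, 'e) manifold =
  mtop :: "'a topology"
  atlas :: "('a, 'e) chart set"

definition points :: "('a, 'e) manifold \<Rightarrow> 'a set" where
  "points M = topspace (mtop M)"

definition is_chart :: "'a topology \<Rightarrow> ('a, 'e::real_inner) chart \<Rightarrow> bool" where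
  "is_chart X c \<longleftrightarrow> (case c of (U, \<phi>) \<Rightarrow>
     openin X U \<and> open (\<phi> ` U) \<and>
     homeomorphic_map (subtopology X U) (top_of_set (\<phi> ` U)) \<phi>)"

definition cimage :: "('a, 'e) chart \<Rightarrow> 'e set" where
  "cimage c = snd c ` fst c"

definition cinv :: "('a, 'e) chart \<Rightarrow> 'e \<Rightarrow> 'a" where
  "cinv c = inv_into (fst c) (snd c)"

definition compatible ::
    "('a, 'e::real_inner) chart \<Rightarrow> ('a, 'e) chart \<Rightarrow> bool" where
  "compatible c d \<longleftrightarrow>
     smooth_on (snd c ` (fst c \<inter> fst d)) (snd d \<circ> cinv c) \<and>
     smooth_on (snd d ` (fst c \<inter> fst d)) (snd c \<circ> cinv d)"

definition smooth_manifold :: "('a, 'e::real_inner) manifold \<Rightarrow> bool" where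
  "smooth_manifold M \<longleftrightarrow>
     (\<exists>B :: 'e set. finite B \<and> span B = UNIV) \<and>
     Hausdorff_space (mtop M) \<and> second_countable (mtop M) \<and>
     (\<forall>c\<in>atlas M. is_chart (mtop M) c) \<and>
     (\<forall>c\<in>atlas M. \<forall>d\<in>atlas M. compatible c d) \<and>
     \<Union> (fst ` atlas M) = points M"

text \<open>The maximal atlas:\<close>

definition charts :: "('a, 'e::real_inner) manifold \<Rightarrow> ('a, 'e) chart set" where
  "charts M = {c. is_chart (mtop M) c \<and> (\<forall>d\<in>atlas M. compatible c d)}"

definition charts_at :: "('a, 'e::real_inner) manifold \<Rightarrow> 'a \<Rightarrow> ('a, 'e) chart set" where
  "charts_at M p = {c \<in> charts M. p \<in> fst c}"

definition smooth_map ::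
    "('a, 'e::real_inner) manifold \<Rightarrow> ('b, 'f::real_inner) manifold \<Rightarrow> ('a \<Rightarrow> 'b) \<Rightarrow> bool" where
  "smooth_map M N f \<longleftrightarrow> f \<in> points M \<rightarrow> points N \<and>
     (\<forall>p\<in>points M. \<exists>c\<in>charts_at M p. \<exists>d\<in>charts_at N (f p).
        f ` fst c \<subseteq> fst d \<and> smooth_on (cimage c) (snd d \<circ> f \<circ> cinv c))"

definition diffeomorphism ::
    "('a, 'e::real_inner) manifold \<Rightarrow> ('b, 'f::real_inner) manifold \<Rightarrow> ('a \<Rightarrow> 'b) \<Rightarrow> bool" where
  "diffeomorphism M N f \<longleftrightarrow> bij_betw f (points M) (points N) \<and>
     smooth_map M N f \<and> smooth_map N M (inv_into (points M) f)"

definition open_submanifold :: "('a, 'e) manifold \<Rightarrow> 'a set \<Rightarrow> ('a, 'e) manifold" where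
  "open_submanifold M U =
     \<lparr>mtop = subtopology (mtop M) U, atlas = (\<lambda>(V, \<phi>). (V \<inter> U, \<phi>)) ` atlas M\<rparr>"

definition prod_manifold ::
    "('a, 'e) manifold \<Rightarrow> ('b, 'f) manifold \<Rightarrow> ('a \<times> 'b, 'e \<times> 'f) manifold" where
  "prod_manifold M N =
     \<lparr>mtop = prod_topology (mtop M) (mtop N),
      atlas = {(U \<times> V, map_prod \<phi> \<psi>) | U \<phi> V \<psi>. (U, \<phi>) \<in> atlas M \<and> (V, \<psi>) \<in> atlas N}\<rparr>"

text \<open>The structure induced on an embedded submanifold \<open>N\<close>: its charts are the restrictions of
  slice charts of \<open>M\<close>. A slice chart maps \<open>U \<inter> N\<close> onto the part of \<open>\<phi> ` U\<close> in a linear subspace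
  \<open>L\<close>, and \<open>L\<close> is identified with the model space \<open>'f\<close> of \<open>N\<close> by a linear map \<open>A\<close>.\<close>

definition submanifold ::
    "('a, 'e::real_inner) manifold \<Rightarrow> 'a set \<Rightarrow> ('a, 'f::real_inner) manifold" where
  "submanifold M N =
     \<lparr>mtop = subtopology (mtop M) N,
      atlas = {(U \<inter> N, A \<circ> \<phi>) | U \<phi> A. (U, \<phi>) \<in> charts M \<and> linear A \<and>
        (\<exists>L. subspace L \<and> bij_betw A L UNIV \<and> \<phi> ` (U \<inter> N) = \<phi> ` U \<inter> L)}\<rparr>"

section \<open>Tangent vectors and vector fields\<close>

text \<open>A tangent vector at \<open>p\<close> is the family of its coordinate vectors in all charts around \<open>p\<close>,
  related to each other by the derivatives of the chart transitions.\<close>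

type_synonym ('a, 'e) tvec = "('a, 'e) chart \<Rightarrow> 'e"

definition tangent_space ::
    "('a, 'e::real_inner) manifold \<Rightarrow> 'a \<Rightarrow> ('a, 'e) tvec set" where
  "tangent_space M p = {v \<in> extensional (charts_at M p).
     \<forall>c\<in>charts_at M p. \<forall>d\<in>charts_at M p.
       v d = frechet_derivative (snd d \<circ> cinv c) (at (snd c p)) (v c)}"

text \<open>By the chain rule the tangent map does not depend on the chosen chart \<open>c\<close>.\<close>

definition tangent_map ::
    "('a, 'e::real_inner) manifold \<Rightarrow> ('b, 'f::real_inner) manifold \<Rightarrow> ('a \<Rightarrow> 'b) \<Rightarrow> 'a \<Rightarrow>
     ('a, 'e) tvec \<Rightarrow> ('b, 'f) tvec" where
  "tangent_map M N f p v = (let c = (SOME c. c \<in> charts_at M p) in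
     (\<lambda>d\<in>charts_at N (f p).
        frechet_derivative (snd d \<circ> f \<circ> cinv c) (at (snd c p)) (v c)))"

definition vector_field ::
    "('a, 'e::real_inner) manifold \<Rightarrow> ('a \<Rightarrow> ('a, 'e) tvec) \<Rightarrow> bool" where
  "vector_field M X \<longleftrightarrow> (\<forall>p\<in>points M. X p \<in> tangent_space M p) \<and>
     (\<forall>c\<in>charts M. smooth_on (cimage c) (\<lambda>x. X (cinv c x) c))"

section \<open>The diffeomorphism group\<close>

text \<open>As in \<open>BijGroup\<close>, diffeomorphisms are extensional functions on the points of the manifold.\<close>

definition Diff_group :: "('a, 'e::real_inner) manifold \<Rightarrow> ('a \<Rightarrow> 'a) monoid" where
  "Diff_group S = BijGroup (points S)
     \<lparr>carrier := {h \<in> Bij (points S). diffeomorphism S S h}\<rparr>"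

definition invariant_field ::
    "('a, 'e::real_inner) manifold \<Rightarrow> ('a \<Rightarrow> 'a) set \<Rightarrow> ('a \<Rightarrow> ('a, 'e) tvec) \<Rightarrow> bool" where
  "invariant_field S H X \<longleftrightarrow>
     (\<forall>h\<in>H. \<forall>x\<in>points S. tangent_map S S h x (X x) = X (h x))"

section \<open>Multi-fiber bundles\<close>

definition over :: "('m, 'e) manifold \<Rightarrow> ('m \<Rightarrow> 'b) \<Rightarrow> 'b set \<Rightarrow> 'm set" where
  "over M \<pi> U = {p \<in> points M. \<pi> p \<in> U}"

definition bundle_chart ::
    "('m, 'em::real_inner) manifold \<Rightarrow> ('b, 'eb::real_inner) manifold \<Rightarrow> ('m \<Rightarrow> 'b) \<Rightarrow>
     ('s, 'es::real_inner) manifold \<Rightarrow> ('w, 'ew::real_inner) manifold \<Rightarrow>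
     'b set \<Rightarrow> ('m \<Rightarrow> 'b \<times> 's \<times> 'w) \<Rightarrow> bool" where
  "bundle_chart M B \<pi> S W U \<phi> \<longleftrightarrow> openin (mtop B) U \<and>
     diffeomorphism (open_submanifold M (over M \<pi> U))
       (prod_manifold (open_submanifold B U) (prod_manifold S W)) \<phi> \<and>
     (\<forall>p\<in>over M \<pi> U. fst (\<phi> p) = \<pi> p)"

definition bundle_atlas ::
    "('m, 'em::real_inner) manifold \<Rightarrow> ('b, 'eb::real_inner) manifold \<Rightarrow> ('m \<Rightarrow> 'b) \<Rightarrow>
     ('s, 'es::real_inner) manifold \<Rightarrow> ('w, 'ew::real_inner) manifold \<Rightarrow>
     'i set \<Rightarrow> ('i \<Rightarrow> 'b set) \<Rightarrow> ('i \<Rightarrow> 'm \<Rightarrow> 'b \<times> 's \<times> 'w) \<Rightarrow> bool" where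
  "bundle_atlas M B \<pi> S W A U \<phi> \<longleftrightarrow>
     (\<forall>\<alpha>\<in>A. bundle_chart M B \<pi> S W (U \<alpha>) (\<phi> \<alpha>)) \<and> (\<Union>\<alpha>\<in>A. U \<alpha>) = points B"

definition hcomp :: "('m \<Rightarrow> 'b \<times> 's \<times> 'w) \<Rightarrow> 'm \<Rightarrow> 's" where
  "hcomp \<phi> p = fst (snd (\<phi> p))"

definition fcomp :: "('m \<Rightarrow> 'b \<times> 's \<times> 'w) \<Rightarrow> 'm \<Rightarrow> 'w" where
  "fcomp \<phi> p = snd (snd (\<phi> p))"

text \<open>The \<open>S\<close>-fiber and the \<open>W\<close>-fiber through \<open>p\<close> as seen in one bundle chart:\<close>

definition S_slice ::
    "('m, 'em) manifold \<Rightarrow> ('m \<Rightarrow> 'b) \<Rightarrow> ('s, 'es) manifold \<Rightarrow>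
     'b set \<Rightarrow> ('m \<Rightarrow> 'b \<times> 's \<times> 'w) \<Rightarrow> 'm \<Rightarrow> 'm set" where
  "S_slice M \<pi> S U \<phi> p = {q \<in> over M \<pi> U. \<phi> q \<in> {\<pi> p} \<times> points S \<times> {fcomp \<phi> p}}"

definition W_slice ::
    "('m, 'em) manifold \<Rightarrow> ('m \<Rightarrow> 'b) \<Rightarrow> ('w, 'ew) manifold \<Rightarrow>
     'b set \<Rightarrow> ('m \<Rightarrow> 'b \<times> 's \<times> 'w) \<Rightarrow> 'm \<Rightarrow> 'm set" where
  "W_slice M \<pi> W U \<phi> p = {q \<in> over M \<pi> U. \<phi> q \<in> {\<pi> p} \<times> {hcomp \<phi> p} \<times> points W}"

definition multi_fiber_atlas ::
    "('m, 'em::real_inner) manifold \<Rightarrow> ('b, 'eb::real_inner) manifold \<Rightarrow> ('m \<Rightarrow> 'b) \<Rightarrow>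
     ('s, 'es::real_inner) manifold \<Rightarrow> ('w, 'ew::real_inner) manifold \<Rightarrow>
     'i set \<Rightarrow> ('i \<Rightarrow> 'b set) \<Rightarrow> ('i \<Rightarrow> 'm \<Rightarrow> 'b \<times> 's \<times> 'w) \<Rightarrow> bool" where
  "multi_fiber_atlas M B \<pi> S W A U \<phi> \<longleftrightarrow> bundle_atlas M B \<pi> S W A U \<phi> \<and>
     (\<forall>\<alpha>\<in>A. \<forall>\<beta>\<in>A. \<forall>p\<in>over M \<pi> (U \<alpha> \<inter> U \<beta>).
        S_slice M \<pi> S (U \<alpha>) (\<phi> \<alpha>) p = S_slice M \<pi> S (U \<beta>) (\<phi> \<beta>) p \<and>
        W_slice M \<pi> W (U \<alpha>) (\<phi> \<alpha>) p = W_slice M \<pi> W (U \<beta>) (\<phi> \<beta>) p)"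

text \<open>For a multi-fiber atlas the choice of \<open>\<alpha>\<close> below is immaterial.\<close>

definition S_fiber ::
    "('m, 'em) manifold \<Rightarrow> ('m \<Rightarrow> 'b) \<Rightarrow> ('s, 'es) manifold \<Rightarrow>
     'i set \<Rightarrow> ('i \<Rightarrow> 'b set) \<Rightarrow> ('i \<Rightarrow> 'm \<Rightarrow> 'b \<times> 's \<times> 'w) \<Rightarrow> 'm \<Rightarrow> 'm set" where
  "S_fiber M \<pi> S A U \<phi> p =
     (let \<alpha> = (SOME \<alpha>. \<alpha> \<in> A \<and> \<pi> p \<in> U \<alpha>) in S_slice M \<pi> S (U \<alpha>) (\<phi> \<alpha>) p)"

definition S_fiber_manifold ::
    "('m, 'em::real_inner) manifold \<Rightarrow> ('m \<Rightarrow> 'b) \<Rightarrow> ('s, 'es::real_inner) manifold \<Rightarrow>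
     'i set \<Rightarrow> ('i \<Rightarrow> 'b set) \<Rightarrow> ('i \<Rightarrow> 'm \<Rightarrow> 'b \<times> 's \<times> 'w) \<Rightarrow> 'm \<Rightarrow> ('m, 'es) manifold" where
  "S_fiber_manifold M \<pi> S A U \<phi> p = submanifold M (S_fiber M \<pi> S A U \<phi> p)"

text \<open>\<open>h\<^sub>\<alpha>\<^sub>\<beta>(p)\<close>, and the group \<open>H\<close> generated by these diffeomorphisms:\<close>

definition h_transition ::
    "('m, 'em) manifold \<Rightarrow> ('m \<Rightarrow> 'b) \<Rightarrow> ('s, 'es) manifold \<Rightarrow>
     'i set \<Rightarrow> ('i \<Rightarrow> 'b set) \<Rightarrow> ('i \<Rightarrow> 'm \<Rightarrow> 'b \<times> 's \<times> 'w) \<Rightarrow> 'i \<Rightarrow> 'i \<Rightarrow> 'm \<Rightarrow> 's \<Rightarrow> 's" where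
  "h_transition M \<pi> S A U \<phi> \<alpha> \<beta> p =
     compose (points S) (hcomp (\<phi> \<alpha>)) (inv_into (S_fiber M \<pi> S A U \<phi> p) (hcomp (\<phi> \<beta>)))"

definition structure_group ::
    "('m, 'em) manifold \<Rightarrow> ('m \<Rightarrow> 'b) \<Rightarrow> ('s, 'es::real_inner) manifold \<Rightarrow>
     'i set \<Rightarrow> ('i \<Rightarrow> 'b set) \<Rightarrow> ('i \<Rightarrow> 'm \<Rightarrow> 'b \<times> 's \<times> 'w) \<Rightarrow> ('s \<Rightarrow> 's) set" where
  "structure_group M \<pi> S A U \<phi> = generate (Diff_group S)
     {h_transition M \<pi> S A U \<phi> \<alpha> \<beta> p | \<alpha> \<beta> p. \<alpha> \<in> A \<and> \<beta> \<in> A \<and> p \<in> over M \<pi> (U \<alpha> \<inter> U \<beta>)}"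

definition T_h ::
    "('m, 'em::real_inner) manifold \<Rightarrow> ('m \<Rightarrow> 'b) \<Rightarrow> ('s, 'es::real_inner) manifold \<Rightarrow>
     'i set \<Rightarrow> ('i \<Rightarrow> 'b set) \<Rightarrow> ('i \<Rightarrow> 'm \<Rightarrow> 'b \<times> 's \<times> 'w) \<Rightarrow> 'i \<Rightarrow> 'm \<Rightarrow>
     ('m, 'es) tvec \<Rightarrow> ('s, 'es) tvec" where
  "T_h M \<pi> S A U \<phi> \<alpha> p = tangent_map (S_fiber_manifold M \<pi> S A U \<phi> p) S (hcomp (\<phi> \<alpha>)) p"

text \<open>The lifted vector, transported to \<open>M\<close> by the tangent map of the inclusion of the
  \<open>S\<close>-fiber through \<open>p\<close>:\<close>

definition fiber_lift ::
    "('m, 'em::real_inner) manifold \<Rightarrow> ('m \<Rightarrow> 'b) \<Rightarrow> ('s, 'es::real_inner) manifold \<Rightarrow>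
     'i set \<Rightarrow> ('i \<Rightarrow> 'b set) \<Rightarrow> ('i \<Rightarrow> 'm \<Rightarrow> 'b \<times> 's \<times> 'w) \<Rightarrow>
     ('s \<Rightarrow> ('s, 'es) tvec) \<Rightarrow> 'i \<Rightarrow> 'm \<Rightarrow> ('m, 'em) tvec" where
  "fiber_lift M \<pi> S A U \<phi> X \<alpha> p =
     tangent_map (S_fiber_manifold M \<pi> S A U \<phi> p) M (\<lambda>q. q) p
       (inv_into (tangent_space (S_fiber_manifold M \<pi> S A U \<phi> p) p)
          (T_h M \<pi> S A U \<phi> \<alpha> p) (X (hcomp (\<phi> \<alpha>) p)))"

end

theory Submission
  imports Defs
begin

text \<open>Around a point \<open>p\<close>, charts \<open>a\<close>, \<open>s\<close>, \<open>w\<close> of the base, of \<open>S\<close> and of \<open>W\<close> combine with a bundle chart to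
  coordinates \<open>\<xi> = (a \<circ> \<pi>, s \<circ> h\<^sub>\<alpha>, w \<circ> f\<^sub>\<alpha>)\<close> on \<open>M\<close>. In them the \<open>S\<close>-fiber through \<open>p\<close> is an affine slice
  with chart \<open>s \<circ> h\<^sub>\<alpha>\<close>, so \<open>h\<^sub>\<alpha>\<close> restricted to the fiber is the identity in coordinates, and the lift of
  \<open>X\<close> has the \<open>\<xi>\<close>-components \<open>(0, X(h\<^sub>\<alpha> p), 0)\<close>, which depend smoothly on \<open>p\<close>. Two bundle charts
  give two charts of the same fiber whose transition is the coordinate form of \<open>h\<^sub>\<alpha>\<^sub>\<beta>\<close>; invariance of
  \<open>X\<close> under \<open>h\<^sub>\<alpha>\<^sub>\<beta>\<close> therefore makes both lifts agree.\<close>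

section \<open>Finite-dimensional inner product spaces\<close>

text \<open>Three obstacles shape the development. Charts of \<open>M\<close> take values in
  \<open>'em\<close>, while bundle coordinates live in \<open>'eb \<times> 'es \<times> 'ew\<close>;
  these are different types, so \<xi> can neither belong to \<open>charts M\<close> nor index a
  component of a tangent vector. It is therefore treated as a chart with a foreign model space, and
  it becomes a genuine chart of \<open>M\<close> only after composition with a linear isomorphism,
  namely the derivative of a transition at one point. \<open>Ck_on\<close> controls derivatives only
  along fixed vectors, whereas the chain rule evaluates them along moving ones. Expansion of the
  moving vector in a finite frame bridges this gap. The fiber carries the atlas of all slice charts
  of \<open>M\<close>, and tangent maps on it are computed in an unspecified chart of the maximal
  atlas. Everything about them is hence reduced to differentiability at the single point in
  question, read off in one convenient pair of charts.\<close>

definition finite_dim :: "'a::real_vector itself \<Rightarrow> bool" where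
  "finite_dim _ \<longleftrightarrow> (\<exists>B::'a set. finite B \<and> span B = UNIV)"

text \<open>Stands in for an orthonormal basis: later arguments use only the reconstruction formula.
  In dimension 0 the empty set qualifies.\<close>

definition parseval_frame :: "'a::real_inner set \<Rightarrow> bool" where
  "parseval_frame B \<longleftrightarrow> finite B \<and> (\<forall>x. x = (\<Sum>b\<in>B. (x \<bullet> b) *\<^sub>R b))"

text \<open>Gram-Schmidt applied to a finite spanning set, followed by normalisation. The spanning
  set may be linearly dependent, so the zero vector can occur in the orthogonal family and is
  removed before dividing by norms.\<close>

lemma finite_dim_frame:
  assumes "finite_dim TYPE('a::real_inner)"
  obtains B :: "'a::real_inner set" where "parseval_frame B"
proof -
  obtain B0 :: "'a set" where "finite B0" "span B0 = UNIV"
    using assms by (auto simp: finite_dim_def)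
  then obtain C :: "'a set" where C: "finite C" "span C = UNIV" "pairwise orthogonal C"
    using basis_orthogonal[of B0] by auto
  define B where "B = (\<lambda>c. c /\<^sub>R norm c) ` (C - {0})"
  have fin: "finite B" using C by (simp add: B_def)
  have nb: "b \<bullet> b = 1" if b: "b \<in> B" for b
  proof -
    obtain c where c: "b = c /\<^sub>R norm c" "c \<noteq> 0" using b by (auto simp: B_def)
    have "norm b = 1" using c by simp
    then show ?thesis by (simp add: norm_eq_sqrt_inner)
  qed
  have ort: "b \<bullet> b' = 0" if b: "b \<in> B" "b' \<in> B" "b \<noteq> b'" for b b'
  proof -
    obtain c c' where c: "b = c /\<^sub>R norm c" "c \<in> C" "b' = c' /\<^sub>R norm c'" "c' \<in> C"
      using b by (auto simp: B_def)
    with b(3) have "c \<noteq> c'" by auto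
    then have "c \<bullet> c' = 0" using C(3) c by (auto simp: pairwise_def orthogonal_def)
    then show ?thesis by (simp add: c)
  qed
  have "x = (\<Sum>b\<in>B. (x \<bullet> b) *\<^sub>R b)" for x
  proof -
    have "C \<subseteq> span B"
    proof
      fix c assume c: "c \<in> C"
      show "c \<in> span B"
      proof (cases "c = 0")
        case False
        then have "c /\<^sub>R norm c \<in> B" using c by (auto simp: B_def)
        then have "norm c *\<^sub>R (c /\<^sub>R norm c) \<in> span B" by (intro span_scale span_base)
        then show ?thesis using False by simp
      qed (simp add: span_zero)
    qed
    then have "span C \<subseteq> span B" by (intro span_minimal subspace_span)
    then have "x \<in> span B" using C(2) by auto
    then obtain u where u: "x = (\<Sum>b\<in>B. u b *\<^sub>R b)" 
      using span_finite[OF fin] by auto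
    have "x \<bullet> b = u b" if b: "b \<in> B" for b
    proof -
      have "x \<bullet> b = (\<Sum>b'\<in>B. u b' * (b' \<bullet> b))" by (simp add: u inner_sum_left)
      also have "\<dots> = (\<Sum>b'\<in>B. if b' = b then u b else 0)"
        by (rule sum.cong) (use ort b nb in auto)
      finally show ?thesis using b fin by simp
    qed
    then have "(\<Sum>b\<in>B. u b *\<^sub>R b) = (\<Sum>b\<in>B. (x \<bullet> b) *\<^sub>R b)" by simp
    then show ?thesis by (rule trans[OF u])
  qed
  then have "\<forall>x. x = (\<Sum>b\<in>B. (x \<bullet> b) *\<^sub>R b)" by (rule allI)
  with fin have "parseval_frame B" unfolding parseval_frame_def by (rule conjI)
  then show ?thesis by (rule that)
qed

lemma finite_dim_prod:
  assumes "finite_dim TYPE('a::real_inner)" "finite_dim TYPE('b::real_inner)"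
  shows "finite_dim TYPE('a \<times> 'b)"
proof -
  obtain B :: "'a set" where B: "finite B" "span B = UNIV" using assms by (auto simp: finite_dim_def)
  obtain C :: "'b set" where C: "finite C" "span C = UNIV" using assms by (auto simp: finite_dim_def)
  let ?D = "(\<lambda>x. (x, 0::'b)) ` B \<union> (\<lambda>x. (0::'a, x)) ` C"
  have lin: "linear (\<lambda>x::'a. (x, 0::'b))" "linear (\<lambda>x::'b. (0::'a, x))"
    by (auto intro!: linearI)
  have "(x, y) \<in> span ?D" for x y
  proof -
    have "(x, 0) \<in> span ?D" "(0, y) \<in> span ?D"
      using linear_span_image[OF lin(1), of B] linear_span_image[OF lin(2), of C] B C
        span_mono[of "(\<lambda>x. (x, 0::'b)) ` B" ?D] span_mono[of "(\<lambda>x. (0::'a, x)) ` C" ?D] by auto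
    from span_add[OF this] show ?thesis by simp
  qed
  then have "span ?D = UNIV" by auto
  moreover have "finite ?D" using B C by auto
  ultimately show ?thesis unfolding finite_dim_def by blast
qed

text \<open>Separates the two ways in which \<open>f x\<close> can vary: the argument enters through
  scalar coefficients, the map through its values at the fixed vectors \<open>b\<close>.\<close>

lemma linear_frame_expansion:
  assumes "linear f" and "parseval_frame B"
  shows "f x = (\<Sum>b\<in>B. (x \<bullet> b) *\<^sub>R f b)"
proof -
  have x: "x = (\<Sum>b\<in>B. (x \<bullet> b) *\<^sub>R b)"
    using assms(2) unfolding parseval_frame_def by (elim conjE) (erule spec)
  have "f x = f (\<Sum>b\<in>B. (x \<bullet> b) *\<^sub>R b)" by (rule arg_cong[where f = f, OF x])
  also have "\<dots> = (\<Sum>b\<in>B. (x \<bullet> b) *\<^sub>R f b)"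
    by (simp add: linear_sum[OF assms(1)] linear_cmul[OF assms(1)])
  finally show ?thesis .
qed

lemma finite_dim_bounded_linear:
  fixes f :: "'a::real_inner \<Rightarrow> 'b::real_normed_vector"
  assumes "finite_dim TYPE('a)" "linear f"
  shows "bounded_linear f"
proof -
  obtain B :: "'a set" where B: "parseval_frame B"
    using finite_dim_frame[OF assms(1)] by blast
  have eq: "f = (\<lambda>x. \<Sum>b\<in>B. (x \<bullet> b) *\<^sub>R f b)"
    by (rule ext) (rule linear_frame_expansion[OF assms(2) B])
  have "bounded_linear (\<lambda>x. \<Sum>b\<in>B. (x \<bullet> b) *\<^sub>R f b)"
    by (intro bounded_linear_sum bounded_linear_scaleR_const bounded_linear_inner_left)
  then show ?thesis by (rule ssubst[OF eq])
qed

section \<open>Calculus of smooth maps\<close>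

text \<open>On an open set, equality of \<open>f\<close> and \<open>g\<close> holds near each point,
  so their derivatives agree there too and the induction can pass to them.\<close>

lemma Ck_on_cong:
  assumes "open U" "\<And>x. x \<in> U \<Longrightarrow> f x = g x" "Ck_on k U f"
  shows "Ck_on k U g"
  using assms(2,3)
proof (induction k arbitrary: f g)
  case 0
  then show ?case using continuous_on_cong by fastforce
next
  case (Suc k)
  have d: "(g has_derivative frechet_derivative f (at x)) (at x)" if x: "x \<in> U" for x
  proof -
    have "(f has_derivative frechet_derivative f (at x)) (at x)"
      using Suc.prems(2) x by (simp add: frechet_derivative_works)
    then show ?thesis
      using has_derivative_transform_within_open[OF _ assms(1) x] Suc.prems(1) by blast
  qed
  have "g differentiable (at x)" if "x \<in> U" for x
    using d[OF that] by (auto simp: differentiable_def)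
  moreover have "Ck_on k U (\<lambda>x. frechet_derivative g (at x) v)" for v
  proof (rule Suc.IH[of "\<lambda>x. frechet_derivative f (at x) v"])
    show "frechet_derivative f (at x) v = frechet_derivative g (at x) v" if "x \<in> U" for x
      using frechet_derivative_at[OF d[OF that]] by simp
    show "Ck_on k U (\<lambda>x. frechet_derivative f (at x) v)" using Suc.prems(2) by simp
  qed
  ultimately show ?case by simp
qed

text \<open>Derivatives at a point are unique, so an explicit formula \<open>f'\<close> may replace
  \<open>frechet_derivative\<close>. The closure properties below are proved by induction through
  this rule.\<close>

lemma Ck_on_SucI:
  assumes "open U" "\<And>x. x \<in> U \<Longrightarrow> (f has_derivative f' x) (at x)"
    and "\<And>v. Ck_on k U (\<lambda>x. f' x v)"
  shows "Ck_on (Suc k) U f"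
proof -
  have "f differentiable (at x)" if "x \<in> U" for x
    using assms(2)[OF that] by (auto simp: differentiable_def)
  moreover have "Ck_on k U (\<lambda>x. frechet_derivative f (at x) v)" for v
    by (rule Ck_on_cong[OF assms(1) _ assms(3)])
      (simp add: frechet_derivative_at[OF assms(2), symmetric])
  ultimately show ?thesis by simp
qed

lemma Ck_on_SucD:
  assumes "Ck_on (Suc k) U f" "x \<in> U"
  shows "(f has_derivative frechet_derivative f (at x)) (at x)"
  using assms by (simp add: frechet_derivative_works)

lemma Ck_on_Suc_imp: "Ck_on (Suc k) U f \<Longrightarrow> Ck_on k U f"
proof (induction k arbitrary: f)
  case 0
  then show ?case
    by (simp add: continuous_at_imp_continuous_on differentiable_imp_continuous_within)
next
  case (Suc k)
  then show ?case by (metis Ck_on.simps(2))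
qed

lemma Ck_on_subset: "Ck_on k U f \<Longrightarrow> V \<subseteq> U \<Longrightarrow> Ck_on k V f"
  by (induction k arbitrary: f) (auto intro: continuous_on_subset)

lemma Ck_on_local:
  assumes "\<And>x. x \<in> U \<Longrightarrow> \<exists>V. open V \<and> x \<in> V \<and> Ck_on k V f"
  shows "Ck_on k U f"
  using assms
proof (induction k arbitrary: f)
  case 0
  have "isCont f x" if "x \<in> U" for x
    using 0[OF that] by (auto simp: continuous_on_eq_continuous_at)
  then show ?case by (simp add: continuous_at_imp_continuous_on)
next
  case (Suc k)
  have "f differentiable (at x)" if x: "x \<in> U" for x
    using Suc.prems[OF x] by auto
  moreover have "Ck_on k U (\<lambda>x. frechet_derivative f (at x) v)" for v
  proof (rule Suc.IH)
    fix x assume "x \<in> U"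
    from Suc.prems[OF this] show
      "\<exists>V. open V \<and> x \<in> V \<and> Ck_on k V (\<lambda>x. frechet_derivative f (at x) v)" by auto
  qed
  ultimately show ?case by simp
qed

lemma Ck_on_const: "open U \<Longrightarrow> Ck_on k U (\<lambda>x. c)"
proof (induction k arbitrary: c)
  case (Suc k)
  show ?case
    by (rule Ck_on_SucI[where f' = "\<lambda>x v. 0"]) (use Suc in auto)
qed simp

lemma Ck_on_bounded_linear:
  assumes "open U" "bounded_linear f"
  shows "Ck_on k U f"
proof (cases k)
  case 0
  then show ?thesis by (simp add: assms(2) linear_continuous_on)
next
  case (Suc j)
  show ?thesis unfolding Suc
    by (rule Ck_on_SucI[where f' = "\<lambda>x. f"])
      (auto intro: assms Ck_on_const bounded_linear_imp_has_derivative)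
qed

lemma Ck_on_linear_comp:
  assumes "open U" "bounded_linear g" "Ck_on k U f"
  shows "Ck_on k U (\<lambda>x. g (f x))"
  using assms(3)
proof (induction k arbitrary: f)
  case 0
  then show ?case using assms(2) bounded_linear.continuous_on by auto
next
  case (Suc k)
  show ?case
  proof (rule Ck_on_SucI[where f' = "\<lambda>x v. g (frechet_derivative f (at x) v)"])
    show "((\<lambda>x. g (f x)) has_derivative (\<lambda>v. g (frechet_derivative f (at x) v))) (at x)"
      if "x \<in> U" for x
      using bounded_linear.has_derivative[OF assms(2) Ck_on_SucD[OF Suc.prems that]] .
  qed (use Suc assms(1) in auto)
qed

lemma Ck_on_add:
  assumes "open U" "Ck_on k U f" "Ck_on k U g"
  shows "Ck_on k U (\<lambda>x. f x + g x)"
  using assms(2,3)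
proof (induction k arbitrary: f g)
  case 0
  then show ?case by (simp add: continuous_on_add)
next
  case (Suc k)
  show ?case
    by (rule Ck_on_SucI[where f' = "\<lambda>x v. frechet_derivative f (at x) v + frechet_derivative g (at x) v"])
      (use Suc assms in \<open>auto intro!: has_derivative_add Ck_on_SucD\<close>)
qed

lemma Ck_on_sum:
  assumes "open U" "\<And>i. i \<in> I \<Longrightarrow> Ck_on k U (f i)"
  shows "Ck_on k U (\<lambda>x. \<Sum>i\<in>I. f i x)"
  using assms by (induction I rule: infinite_finite_induct) (auto intro: Ck_on_const Ck_on_add)

lemma Ck_on_scaleR:
  fixes f :: "'a::real_normed_vector \<Rightarrow> real"
  assumes "open U" "Ck_on k U f" "Ck_on k U g"
  shows "Ck_on k U (\<lambda>x. f x *\<^sub>R g x)"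
  using assms(2,3)
proof (induction k arbitrary: f g)
  case 0
  then show ?case by (simp add: continuous_on_scaleR)
next
  case (Suc k)
  show ?case
  proof (rule Ck_on_SucI[where f' = "\<lambda>x v. f x *\<^sub>R frechet_derivative g (at x) v
        + frechet_derivative f (at x) v *\<^sub>R g x"])
    fix v
    \<comment> \<open>The product rule brings back \<open>f\<close> and \<open>g\<close>
      undifferentiated, but only at order \<open>k\<close>.\<close>
    have "Ck_on k U f" "Ck_on k U g" using Suc.prems Ck_on_Suc_imp by blast+
    then show "Ck_on k U (\<lambda>x. f x *\<^sub>R frechet_derivative g (at x) v
        + frechet_derivative f (at x) v *\<^sub>R g x)"
      using Suc by (intro Ck_on_add[OF assms(1)]) auto
  qed (use Suc.prems assms in \<open>auto intro!: has_derivative_scaleR Ck_on_SucD\<close>)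
qed

lemma Ck_on_Pair:
  assumes "open U" "Ck_on k U f" "Ck_on k U g"
  shows "Ck_on k U (\<lambda>x. (f x, g x))"
  using assms(2,3)
proof (induction k arbitrary: f g)
  case 0
  then show ?case by (simp add: continuous_on_Pair)
next
  case (Suc k)
  show ?case
    by (rule Ck_on_SucI[where f' = "\<lambda>x v. (frechet_derivative f (at x) v, frechet_derivative g (at x) v)"])
      (use Suc assms in \<open>auto intro!: has_derivative_Pair Ck_on_SucD\<close>)
qed

text \<open>The derivative of the composite in direction \<open>v\<close> is
  \<open>?g' (f x) (?f' x v)\<close>, whose direction moves with \<open>x\<close>. Expanding
  \<open>?f' x v\<close> in a frame leaves products of scalar functions of class \<open>k\<close>
  with the maps \<open>?g' (f x) b\<close> for fixed \<open>b\<close>, and these are composites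
  covered by the induction hypothesis.\<close>

lemma Ck_on_compose:
  fixes f :: "'a::real_normed_vector \<Rightarrow> 'b::real_inner"
  assumes fd: "finite_dim TYPE('b)" and U: "open U" and fUV: "f ` U \<subseteq> V"
    and "Ck_on k U f" "Ck_on k V g"
  shows "Ck_on k U (\<lambda>x. g (f x))"
  using assms(4,5)
proof (induction k arbitrary: g)
  case 0
  then show ?case using fUV continuous_on_compose2[of V g U f] by simp
next
  case (Suc k)
  obtain B :: "'b set" where B: "parseval_frame B"
    using finite_dim_frame[OF fd] by blast
  let ?f' = "\<lambda>x. frechet_derivative f (at x)" and ?g' = "\<lambda>x. frechet_derivative g (at x)"
  show ?case
  proof (rule Ck_on_SucI[where f' = "\<lambda>x v. ?g' (f x) (?f' x v)"])
    fix x assume x: "x \<in> U"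
    then have fx: "f x \<in> V" using fUV by auto
    show "((\<lambda>x. g (f x)) has_derivative (\<lambda>v. ?g' (f x) (?f' x v))) (at x)"
      using has_derivative_compose[OF Ck_on_SucD[OF Suc.prems(1) x] Ck_on_SucD[OF Suc.prems(2) fx]] .
  next
    fix v
    have eq: "(\<Sum>b\<in>B. (?f' x v \<bullet> b) *\<^sub>R ?g' (f x) b) = ?g' (f x) (?f' x v)" if x: "x \<in> U" for x
    proof -
      have "f x \<in> V" using x fUV by auto
      then have "linear (?g' (f x))"
        using linear_frechet_derivative[of g "at (f x)"] Suc.prems(2) by simp
      from linear_frame_expansion[OF this B] show ?thesis by (rule sym)
    qed
    have *: "Ck_on k U (\<lambda>x. \<Sum>b\<in>B. (?f' x v \<bullet> b) *\<^sub>R ?g' (f x) b)"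
    proof (intro Ck_on_sum Ck_on_scaleR U)
      fix b
      show "Ck_on k U (\<lambda>x. ?f' x v \<bullet> b)"
        using Suc.prems(1) by (intro Ck_on_linear_comp[OF U bounded_linear_inner_left]) simp
      show "Ck_on k U (\<lambda>x. ?g' (f x) b)"
        using Suc.prems(2) by (intro Suc.IH Ck_on_Suc_imp[OF Suc.prems(1)]) simp
    qed
    show "Ck_on k U (\<lambda>x. ?g' (f x) (?f' x v))"
      by (rule Ck_on_cong[OF U _ *]) (rule eq)
  qed (rule U)
qed

lemma smooth_on_cong:
  "smooth_on U f \<Longrightarrow> open U \<Longrightarrow> (\<And>x. x \<in> U \<Longrightarrow> f x = g x) \<Longrightarrow> smooth_on U g"
  unfolding smooth_on_def using Ck_on_cong by blast

lemma smooth_on_subset: "smooth_on U f \<Longrightarrow> V \<subseteq> U \<Longrightarrow> smooth_on V f"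
  unfolding smooth_on_def using Ck_on_subset by blast

lemma smooth_on_local:
  "(\<And>x. x \<in> U \<Longrightarrow> \<exists>V. open V \<and> x \<in> V \<and> smooth_on V f) \<Longrightarrow> smooth_on U f"
  unfolding smooth_on_def using Ck_on_local by meson

lemma smooth_on_const: "open U \<Longrightarrow> smooth_on U (\<lambda>x. c)"
  by (simp add: smooth_on_def Ck_on_const)

lemma smooth_on_bounded_linear: "open U \<Longrightarrow> bounded_linear f \<Longrightarrow> smooth_on U f"
  by (simp add: smooth_on_def Ck_on_bounded_linear)

lemma smooth_on_add:
  "open U \<Longrightarrow> smooth_on U f \<Longrightarrow> smooth_on U g \<Longrightarrow> smooth_on U (\<lambda>x. f x + g x)"
  by (simp add: smooth_on_def Ck_on_add)

lemma smooth_on_Pair: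
  "open U \<Longrightarrow> smooth_on U f \<Longrightarrow> smooth_on U g \<Longrightarrow> smooth_on U (\<lambda>x. (f x, g x))"
  by (simp add: smooth_on_def Ck_on_Pair)

lemma smooth_on_compose:
  fixes f :: "'a::real_normed_vector \<Rightarrow> 'b::real_inner"
  assumes "finite_dim TYPE('b)" "open U" "f ` U \<subseteq> V" "smooth_on U f" "smooth_on V g"
  shows "smooth_on U (g \<circ> f)"
  using assms(4,5) Ck_on_compose[OF assms(1-3)] unfolding smooth_on_def o_def by blast

lemma smooth_on_has_derivative:
  "smooth_on U f \<Longrightarrow> x \<in> U \<Longrightarrow> (f has_derivative frechet_derivative f (at x)) (at x)"
  unfolding smooth_on_def using Ck_on_SucD by blast

lemma smooth_on_differentiable: "smooth_on U f \<Longrightarrow> x \<in> U \<Longrightarrow> f differentiable (at x)"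
  using smooth_on_has_derivative differentiable_def by blast

lemma smooth_on_continuous_on: "smooth_on U f \<Longrightarrow> continuous_on U f"
  unfolding smooth_on_def by (metis Ck_on.simps(1))

text \<open>Serves to push a smoothly varying vector \<open>w\<close> forward by a change of
  coordinates \<open>g\<close>. The frame expansion again replaces the moving direction by fixed
  ones.\<close>

lemma smooth_on_frechet_derivative:
  fixes u :: "'a::real_normed_vector \<Rightarrow> 'b::real_inner"
  assumes fd: "finite_dim TYPE('b)" and U: "open U" and uUV: "u ` U \<subseteq> V"
    and g: "smooth_on V g" and u: "smooth_on U u" and w: "smooth_on U w"
  shows "smooth_on U (\<lambda>x. frechet_derivative g (at (u x)) (w x))"
proof -
  obtain B :: "'b set" where B: "parseval_frame B"
    using finite_dim_frame[OF fd] by blast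
  let ?g' = "\<lambda>x. frechet_derivative g (at x)"
  have eq: "(\<Sum>b\<in>B. (w x \<bullet> b) *\<^sub>R ?g' (u x) b) = ?g' (u x) (w x)" if x: "x \<in> U" for x
  proof -
    have "u x \<in> V" using x uUV by auto
    then have "linear (?g' (u x))"
      by (intro linear_frechet_derivative smooth_on_differentiable[OF g])
    from linear_frame_expansion[OF this B] show ?thesis by (rule sym)
  qed
  have *: "Ck_on k U (\<lambda>x. \<Sum>b\<in>B. (w x \<bullet> b) *\<^sub>R ?g' (u x) b)" for k
  proof (intro Ck_on_sum Ck_on_scaleR U)
    fix b
    show "Ck_on k U (\<lambda>x. w x \<bullet> b)"
      using w by (intro Ck_on_linear_comp[OF U bounded_linear_inner_left]) (simp add: smooth_on_def)
    have "Ck_on (Suc k) V g" using g unfolding smooth_on_def by blast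
    then have "Ck_on k V (\<lambda>y. ?g' y b)" by simp
    moreover have "Ck_on k U u" using u unfolding smooth_on_def by blast
    ultimately show "Ck_on k U (\<lambda>x. ?g' (u x) b)"
      using Ck_on_compose[OF fd U uUV] by blast
  qed
  show ?thesis unfolding smooth_on_def
    by (intro allI, rule Ck_on_cong[OF U _ *]) (rule eq)
qed

section \<open>Charts with values in arbitrary model spaces\<close>

text \<open>The domain and the image of a chart are open, so subspace-open sets are open in the
  whole space. The homeomorphism condition thereby turns into statements about preimages and images
  that no longer mention subtopologies.\<close>

lemma is_chart_iff:
  "is_chart X c \<longleftrightarrow> openin X (fst c) \<and> inj_on (snd c) (fst c) \<and>
     (\<forall>G. open G \<longrightarrow> openin X {p \<in> fst c. snd c p \<in> G}) \<and>
     (\<forall>V. openin X V \<longrightarrow> open (snd c ` (fst c \<inter> V)))" (is "?L \<longleftrightarrow> ?R")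
proof -
  obtain U \<phi> where c: "c = (U, \<phi>)" by (cases c)
  show ?thesis
  proof
    assume ?L
    then have U: "openin X U" and op: "open (\<phi> ` U)"
      and hom: "homeomorphic_map (subtopology X U) (top_of_set (\<phi> ` U)) \<phi>"
      by (auto simp: is_chart_def c)
    have ts: "topspace (subtopology X U) = U"
      using openin_subset[OF U] by auto
    have inj: "inj_on \<phi> U" using homeomorphic_imp_injective_map[OF hom] ts by simp
    have "openin X {p \<in> U. \<phi> p \<in> G}" if G: "open G" for G
    proof -
      have "continuous_map (subtopology X U) (top_of_set (\<phi> ` U)) \<phi>"
        using hom by (rule homeomorphic_imp_continuous_map)
      then have "openin (subtopology X U) {p \<in> topspace (subtopology X U). \<phi> p \<in> \<phi> ` U \<inter> G}"
        using G by (intro openin_continuous_map_preimage) (auto intro: openin_open_Int)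
      moreover have "{p \<in> topspace (subtopology X U). \<phi> p \<in> \<phi> ` U \<inter> G} = {p \<in> U. \<phi> p \<in> G}"
        unfolding ts by auto
      ultimately show ?thesis using U openin_trans_full by metis
    qed
    moreover have "open (\<phi> ` (U \<inter> V))" if V: "openin X V" for V
    proof -
      have "openin (subtopology X U) (U \<inter> V)" using V by (auto simp: openin_subtopology)
      then have "openin (top_of_set (\<phi> ` U)) (\<phi> ` (U \<inter> V))"
        using homeomorphic_imp_open_map[OF hom] unfolding open_map_def by blast
      then show ?thesis using op openin_open_trans by blast
    qed
    ultimately show ?R using U inj by (simp add: c)
  next
    assume R: ?R
    then have U: "openin X U" and inj: "inj_on \<phi> U"
      and pre: "\<And>G. open G \<Longrightarrow> openin X {p \<in> U. \<phi> p \<in> G}"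
      and im: "\<And>V. openin X V \<Longrightarrow> open (\<phi> ` (U \<inter> V))" by (simp_all add: c)
    have ts: "topspace (subtopology X U) = U"
      using openin_subset[OF U] by auto
    have "continuous_map (subtopology X U) (top_of_set (\<phi> ` U)) \<phi>"
      unfolding continuous_map_in_subtopology
    proof
      show "continuous_map (subtopology X U) euclidean \<phi>"
        unfolding continuous_map_def ts
        using pre by (auto simp: openin_open_subtopology[OF U])
    qed (use ts in auto)
    moreover have "open_map (subtopology X U) (top_of_set (\<phi> ` U)) \<phi>"
      unfolding open_map_def openin_open_subtopology[OF U]
    proof clarify
      fix V assume V: "openin X V" "V \<subseteq> U"
      then have "open (\<phi> ` V)" using im[OF V(1)] by (simp add: Int_absorb1)
      then show "openin (top_of_set (\<phi> ` U)) (\<phi> ` V)"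
        using V(2) by (intro open_subset) auto
    qed
    ultimately have "homeomorphic_map (subtopology X U) (top_of_set (\<phi> ` U)) \<phi>"
      using inj ts by (intro bijective_open_imp_homeomorphic_map) auto
    moreover have "open (\<phi> ` U)" using im[OF U] by simp
    ultimately show ?L using U by (simp add: is_chart_def c)
  qed
qed

lemma chart_openin: "is_chart X c \<Longrightarrow> openin X (fst c)"
  by (simp add: is_chart_iff)

lemma chart_inj: "is_chart X c \<Longrightarrow> inj_on (snd c) (fst c)"
  by (simp add: is_chart_iff)

lemma chart_openin_preimage: "is_chart X c \<Longrightarrow> open G \<Longrightarrow> openin X {p \<in> fst c. snd c p \<in> G}"
  by (simp add: is_chart_iff)

lemma chart_open_image: "is_chart X c \<Longrightarrow> openin X V \<Longrightarrow> open (snd c ` (fst c \<inter> V))"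
  by (simp add: is_chart_iff)

lemma chart_open_cimage: "is_chart X c \<Longrightarrow> open (cimage c)"
  using chart_open_image[OF _ chart_openin] by (fastforce simp: cimage_def)

lemma cinv_chart: "is_chart X c \<Longrightarrow> p \<in> fst c \<Longrightarrow> cinv c (snd c p) = p"
  by (simp add: cinv_def chart_inj)

lemma cinv_in: "x \<in> cimage c \<Longrightarrow> cinv c x \<in> fst c"
  by (simp add: cinv_def cimage_def inv_into_into)

lemma chart_cinv: "x \<in> cimage c \<Longrightarrow> snd c (cinv c x) = x"
  by (simp add: cinv_def cimage_def f_inv_into_f)

lemma is_chart_points: "is_chart (mtop M) c \<Longrightarrow> fst c \<subseteq> points M"
  unfolding points_def by (intro openin_subset chart_openin)

section \<open>Smooth transitions between charts, including charts in a foreign model space\<close>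

definition smooth_transition ::
    "('a, 'e::real_inner) chart \<Rightarrow> ('a, 'f::real_inner) chart \<Rightarrow> bool" where
  "smooth_transition c d \<longleftrightarrow> smooth_on (snd c ` (fst c \<inter> fst d)) (snd d \<circ> cinv c)"

lemma compatible_iff: "compatible c d \<longleftrightarrow> smooth_transition c d \<and> smooth_transition d c"
  by (simp add: compatible_def smooth_transition_def Int_commute)

text \<open>The model space \<open>'f\<close> need not be the model space \<open>'e\<close> of \<open>M\<close>; this makes it possible to
  treat \<open>B \<times> S \<times> W\<close>-valued coordinates on the total space of a bundle as charts.\<close>

definition model_charts ::
    "('a, 'e::real_inner) manifold \<Rightarrow> ('a, 'f::real_inner) chart set" where
  "model_charts M = {c. is_chart (mtop M) c \<and>
     (\<forall>d\<in>atlas M. smooth_transition c d \<and> smooth_transition d c)}"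

lemma charts_eq_model_charts: "charts M = model_charts M"
  by (simp add: charts_def model_charts_def compatible_iff)

lemma is_chart_model_charts: "c \<in> model_charts M \<Longrightarrow> is_chart (mtop M) c"
  by (simp add: model_charts_def)

text \<open>The differentiable half of \<open>smooth_manifold\<close>. It is the form established
  for open pieces of \<open>M\<close> and for the fibers, where a chart through a given point is
  exhibited when one is called for.\<close>

definition smooth_atlas :: "('a, 'e::real_inner) manifold \<Rightarrow> bool" where
  "smooth_atlas M \<longleftrightarrow> finite_dim TYPE('e) \<and> (\<forall>c\<in>atlas M. is_chart (mtop M) c) \<and>
     (\<forall>c\<in>atlas M. \<forall>d\<in>atlas M. compatible c d)"

lemma smooth_manifold_smooth_atlas: "smooth_manifold M \<Longrightarrow> smooth_atlas M"
  by (auto simp: smooth_manifold_def smooth_atlas_def finite_dim_def)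

lemma atlas_subset_charts: "smooth_atlas M \<Longrightarrow> atlas M \<subseteq> charts M"
  by (auto simp: smooth_atlas_def charts_def)

lemma smooth_manifold_chart_at:
  assumes "smooth_manifold M" "p \<in> points M"
  obtains c where "c \<in> atlas M" "p \<in> fst c"
proof -
  have "p \<in> \<Union> (fst ` atlas M)" using assms by (simp add: smooth_manifold_def)
  then show ?thesis using that by blast
qed

text \<open>On the triple overlap the transition factors through the atlas chart \<open>e\<close>,
  with which both \<open>c\<close> and \<open>d\<close> are compatible.\<close>

lemma smooth_on_transition_near:
  fixes M :: "('a, 'e::real_inner) manifold"
    and c :: "('a, 'f::real_inner) chart" and d :: "('a, 'g::real_inner) chart"
  assumes fd: "finite_dim TYPE('e)" and c: "c \<in> model_charts M" and d: "d \<in> model_charts M"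
    and e: "e \<in> atlas M" "is_chart (mtop M) e"
  shows "smooth_on (snd c ` (fst c \<inter> (fst d \<inter> fst e))) (snd d \<circ> cinv c)"
proof -
  let ?V = "snd c ` (fst c \<inter> (fst d \<inter> fst e))"
  have cc: "is_chart (mtop M) c" and dc: "is_chart (mtop M) d"
    using c d by (auto simp: model_charts_def)
  have op: "open ?V" by (intro chart_open_image[OF cc] openin_Int chart_openin dc e)
  have sm: "smooth_on (snd c ` (fst c \<inter> fst e)) (snd e \<circ> cinv c)"
    "smooth_on (snd e ` (fst e \<inter> fst d)) (snd d \<circ> cinv e)"
    using c d e by (auto simp: model_charts_def smooth_transition_def)
  have "smooth_on ?V ((snd d \<circ> cinv e) \<circ> (snd e \<circ> cinv c))"
  proof (rule smooth_on_compose[OF fd op])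
    show "smooth_on ?V (snd e \<circ> cinv c)" using sm(1) by (rule smooth_on_subset) auto
    show "(snd e \<circ> cinv c) ` ?V \<subseteq> snd e ` (fst e \<inter> fst d)" by (auto simp: cinv_chart[OF cc])
  qed (rule sm)
  then show ?thesis
    by (rule smooth_on_cong[OF _ op]) (auto simp: cinv_chart[OF cc] cinv_chart[OF e(2)])
qed

text \<open>Compatibility of \<open>c\<close> and \<open>d\<close> is known with atlas charts only.
  Some atlas chart contains any given common point, so the transition is smooth near it, and
  smoothness is local.\<close>

lemma model_charts_smooth_transition:
  assumes M: "smooth_manifold M" and c: "c \<in> model_charts M" and d: "d \<in> model_charts M"
  shows "smooth_transition c d"
  unfolding smooth_transition_def
proof (rule smooth_on_local)
  fix x assume "x \<in> snd c ` (fst c \<inter> fst d)"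
  then obtain p where p: "x = snd c p" "p \<in> fst c" "p \<in> fst d" by auto
  have cc: "is_chart (mtop M) c" and dc: "is_chart (mtop M) d"
    using c d by (auto simp: model_charts_def)
  have "p \<in> points M" using is_chart_points[OF cc] p(2) by auto
  then obtain e where e: "e \<in> atlas M" "p \<in> fst e" by (rule smooth_manifold_chart_at[OF M])
  have ec: "is_chart (mtop M) e" and fd: "finite_dim TYPE('b)"
    using e smooth_manifold_smooth_atlas[OF M] by (auto simp: smooth_atlas_def)
  have "open (snd c ` (fst c \<inter> (fst d \<inter> fst e)))"
    by (intro chart_open_image[OF cc] openin_Int chart_openin dc ec)
  moreover have "smooth_on (snd c ` (fst c \<inter> (fst d \<inter> fst e))) (snd d \<circ> cinv c)"
    by (rule smooth_on_transition_near[OF fd c d e(1) ec])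
  ultimately show "\<exists>V. open V \<and> x \<in> V \<and> smooth_on V (snd d \<circ> cinv c)"
    using p e(2) by blast
qed

text \<open>Changing the model space by a global diffeomorphism \<open>T\<close> keeps all
  transitions smooth. With \<open>T\<close> an affine isomorphism onto the model space of
  \<open>M\<close>, foreign coordinates become a member of \<open>charts M\<close>.\<close>

lemma model_chart_compose:
  fixes c :: "('a, 'f::real_inner) chart" and T :: "'f \<Rightarrow> 'g::real_inner"
  assumes M: "smooth_atlas M" and fd: "finite_dim TYPE('f)" and c: "c \<in> model_charts M"
    and T: "smooth_on UNIV T" and T': "smooth_on UNIV T'"
    and inv: "\<And>x. T' (T x) = x" "\<And>y. T (T' y) = y"
  shows "(fst c, T \<circ> snd c) \<in> model_charts M"
proof -
  let ?c = "(fst c, T \<circ> snd c)"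
  have cc: "is_chart (mtop M) c" using c by (simp add: model_charts_def)
  have injT: "inj T" using inv by (metis injI)
  have opT: "open (T ` G)" if "open G" for G
  proof -
    have "T ` G = T' -` G" using inv by (auto simp: image_iff) metis
    moreover have "open (T' -` G)"
      using that smooth_on_continuous_on[OF T'] by (simp add: continuous_on_open_vimage)
    ultimately show ?thesis by simp
  qed
  have ch: "is_chart (mtop M) ?c"
    unfolding is_chart_iff
  proof (intro conjI allI impI)
    show "inj_on (snd ?c) (fst ?c)"
      using chart_inj[OF cc] injT by (auto simp: inj_on_def)
    show "openin (mtop M) {p \<in> fst ?c. snd ?c p \<in> G}" if "open G" for G
    proof -
      have "open (T -` G)"
        using that smooth_on_continuous_on[OF T] by (simp add: continuous_on_open_vimage)
      from chart_openin_preimage[OF cc this] show ?thesis by simp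
    qed
    show "open (snd ?c ` (fst ?c \<inter> V))" if "openin (mtop M) V" for V
      using opT[OF chart_open_image[OF cc that]] by (simp add: image_comp)
  qed (simp add: chart_openin[OF cc])
  moreover have "smooth_transition ?c d" "smooth_transition d ?c" if d: "d \<in> atlas M" for d
  proof -
    have dc: "is_chart (mtop M) d" using M d by (auto simp: smooth_atlas_def)
    have tr: "smooth_on (snd c ` (fst c \<inter> fst d)) (snd d \<circ> cinv c)"
      "smooth_on (snd d ` (fst d \<inter> fst c)) (snd c \<circ> cinv d)"
      using c d by (auto simp: model_charts_def smooth_transition_def)
    show "smooth_transition d ?c"
      using smooth_on_compose[OF fd chart_open_image[OF dc chart_openin[OF cc]] _ tr(2) T]
      by (simp add: smooth_transition_def comp_assoc)
    let ?D = "snd ?c ` (fst ?c \<inter> fst d)"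
    have D: "open ?D" by (rule chart_open_image[OF ch chart_openin[OF dc]])
    have "smooth_on ?D ((snd d \<circ> cinv c) \<circ> T')"
      by (rule smooth_on_compose[OF fd D _ smooth_on_subset[OF T'] tr(1)]) (auto simp: inv)
    moreover have "cinv ?c (T (snd c p)) = cinv c (snd c p)" if "p \<in> fst c" for p
      using cinv_chart[OF ch, of p] cinv_chart[OF cc, of p] that by simp
    ultimately show "smooth_transition ?c d"
      unfolding smooth_transition_def by (elim smooth_on_cong[OF _ D]) (auto simp: inv)
  qed
  ultimately show ?thesis by (simp add: model_charts_def)
qed

section \<open>Smooth maps and diffeomorphisms in coordinates\<close>

lemma smooth_map_openin_preimage:
  assumes f: "smooth_map M N f" and V: "openin (mtop N) V"
  shows "openin (mtop M) {p \<in> points M. f p \<in> V}"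
proof (subst openin_subopen, safe)
  fix p assume p: "p \<in> points M" "f p \<in> V"
  obtain c d where c: "c \<in> charts M" "p \<in> fst c" and d: "d \<in> charts N" "f p \<in> fst d"
    and fcd: "f ` fst c \<subseteq> fst d" and sm: "smooth_on (cimage c) (snd d \<circ> f \<circ> cinv c)"
    using f p(1) unfolding smooth_map_def charts_at_def by blast
  have cc: "is_chart (mtop M) c" and dc: "is_chart (mtop N) d"
    using c d by (auto simp: charts_def)
  \<comment> \<open>\<open>smooth_map\<close> says nothing about topologies. Continuity at
    \<open>p\<close> is extracted from the coordinate expression, which is continuous on all of
    \<open>cimage c\<close> because \<open>f\<close> sends the whole domain of \<open>c\<close> into
    that of \<open>d\<close>; injectivity of \<open>d\<close> then returns from coordinates to
    points.\<close>
  define G where "G = cimage c \<inter> (snd d \<circ> f \<circ> cinv c) -` (snd d ` (fst d \<inter> V))"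
  have "open G" unfolding G_def
    by (rule continuous_open_preimage[OF smooth_on_continuous_on[OF sm] chart_open_cimage[OF cc]
          chart_open_image[OF dc V]])
  then have "openin (mtop M) {q \<in> fst c. snd c q \<in> G}" by (rule chart_openin_preimage[OF cc])
  moreover have "p \<in> {q \<in> fst c. snd c q \<in> G}"
    using c d p by (auto simp: G_def cinv_chart[OF cc] cimage_def)
  moreover have "{q \<in> fst c. snd c q \<in> G} \<subseteq> {p \<in> points M. f p \<in> V}"
  proof safe
    fix q assume q: "q \<in> fst c" "snd c q \<in> G"
    show "q \<in> points M" using q is_chart_points[OF cc] by auto
    have "snd d (f q) \<in> snd d ` (fst d \<inter> V)" using q by (auto simp: G_def cinv_chart[OF cc])
    moreover have "f q \<in> fst d" using fcd q by auto
    ultimately show "f q \<in> V" using chart_inj[OF dc] by (auto dest: inj_onD)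
  qed
  ultimately show "\<exists>T. openin (mtop M) T \<and> p \<in> T \<and> T \<subseteq> {p \<in> points M. f p \<in> V}" by blast
qed

text \<open>\<open>smooth_map\<close> provides some pair of charts near each point; reaching
  \<open>c\<close> and \<open>e\<close> costs one transition on either side. These transitions are
  assumed in just the direction in which they are composed, which allows \<open>c\<close> and
  \<open>e\<close> to have foreign model spaces.\<close>

lemma smooth_map_coordinates:
  fixes M :: "('a, 'e::real_inner) manifold" and N :: "('b, 'f::real_inner) manifold"
    and c :: "('a, 'g::real_inner) chart" and e :: "('b, 'h::real_inner) chart"
  assumes fd: "finite_dim TYPE('e)" "finite_dim TYPE('f)"
    and f: "smooth_map M N f"
    and cc: "is_chart (mtop M) c" and ct: "\<And>d. d \<in> charts M \<Longrightarrow> smooth_transition c d"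
    and ec: "is_chart (mtop N) e" and et: "\<And>d. d \<in> charts N \<Longrightarrow> smooth_transition d e"
  shows "smooth_on (snd c ` {p \<in> fst c. f p \<in> fst e}) (snd e \<circ> f \<circ> cinv c)"
proof (rule smooth_on_local)
  fix x assume "x \<in> snd c ` {p \<in> fst c. f p \<in> fst e}"
  then obtain p where p: "x = snd c p" "p \<in> fst c" "f p \<in> fst e" by auto
  have pM: "p \<in> points M" using p(2) is_chart_points[OF cc] by auto
  obtain c' d' where c': "c' \<in> charts M" "p \<in> fst c'" and d': "d' \<in> charts N" "f p \<in> fst d'"
    and fcd: "f ` fst c' \<subseteq> fst d'" and sm: "smooth_on (cimage c') (snd d' \<circ> f \<circ> cinv c')"
    using f pM unfolding smooth_map_def charts_at_def by blast
  have cc': "is_chart (mtop M) c'" and dc': "is_chart (mtop N) d'"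
    using c' d' by (auto simp: charts_def)
  define V where "V = snd c ` (fst c \<inter> (fst c' \<inter> {p \<in> points M. f p \<in> fst e}))"
  have op: "open V" unfolding V_def
    by (intro chart_open_image[OF cc] openin_Int chart_openin cc' smooth_map_openin_preimage[OF f] ec)
  have c1: "smooth_on V (snd c' \<circ> cinv c)"
    using ct[OF c'(1)] unfolding smooth_transition_def V_def by (rule smooth_on_subset) auto
  have c2: "smooth_on V ((snd d' \<circ> f \<circ> cinv c') \<circ> (snd c' \<circ> cinv c))"
    by (rule smooth_on_compose[OF fd(1) op _ c1 sm]) (auto simp: V_def cimage_def cinv_chart[OF cc])
  have "smooth_on V ((snd e \<circ> cinv d') \<circ> ((snd d' \<circ> f \<circ> cinv c') \<circ> (snd c' \<circ> cinv c)))"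
    by (rule smooth_on_compose[OF fd(2) op _ c2 et[OF d'(1), unfolded smooth_transition_def]])
      (use fcd in \<open>auto simp: V_def cinv_chart[OF cc] cinv_chart[OF cc']\<close>)
  then have "smooth_on V (snd e \<circ> f \<circ> cinv c)"
    by (rule smooth_on_cong[OF _ op])
      (use fcd in \<open>auto simp: V_def cinv_chart[OF cc] cinv_chart[OF cc'] cinv_chart[OF dc']\<close>)
  moreover have "x \<in> V" using p c' pM by (auto simp: V_def)
  ultimately show "\<exists>V. open V \<and> x \<in> V \<and> smooth_on V (snd e \<circ> f \<circ> cinv c)"
    using op by blast
qed

text \<open>Transitions into the pulled-back chart are coordinate expressions of \<open>F\<close>,
  those out of it are coordinate expressions of the inverse of \<open>F\<close>; both are smooth
  since \<open>F\<close> is a diffeomorphism.\<close>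

lemma diffeomorphism_pullback_chart:
  fixes M :: "('a, 'e::real_inner) manifold" and N :: "('b, 'f::real_inner) manifold"
    and e :: "('b, 'g::real_inner) chart"
  assumes M: "smooth_atlas M" and fd: "finite_dim TYPE('f)" and F: "diffeomorphism M N F"
    and ec: "is_chart (mtop N) e"
    and et: "\<And>d. d \<in> charts N \<Longrightarrow> smooth_transition d e \<and> smooth_transition e d"
  shows "({p \<in> points M. F p \<in> fst e}, snd e \<circ> F) \<in> model_charts M"
proof -
  define O' where "O' = {p \<in> points M. F p \<in> fst e}"
  define G where "G = inv_into (points M) F"
  let ?c = "(O', snd e \<circ> F)"
  have bij: "bij_betw F (points M) (points N)" and smF: "smooth_map M N F" and smG: "smooth_map N M G"
    using F by (auto simp: diffeomorphism_def G_def)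
  have GF: "G (F p) = p" if "p \<in> points M" for p
    using bij that by (simp add: G_def bij_betw_inv_into_left)
  have FG: "F (G q) = q" "G q \<in> points M" if "q \<in> points N" for q
    using bij that by (auto simp: G_def bij_betw_inv_into_right bij_betw_def inv_into_into)
  have eN: "fst e \<subseteq> points N" using is_chart_points[OF ec] .
  have fdM: "finite_dim TYPE('e)" using M by (simp add: smooth_atlas_def)
  have ch: "is_chart (mtop M) ?c"
    unfolding is_chart_iff fst_conv snd_conv
  proof (intro conjI allI impI)
    show "openin (mtop M) O'" unfolding O'_def
      by (rule smooth_map_openin_preimage[OF smF chart_openin[OF ec]])
    show "inj_on (snd e \<circ> F) O'"
      using bij chart_inj[OF ec] by (auto simp: O'_def bij_betw_def inj_on_def)
    show "openin (mtop M) {p \<in> O'. (snd e \<circ> F) p \<in> H}" if "open H" for H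
      using smooth_map_openin_preimage[OF smF chart_openin_preimage[OF ec that]]
      by (simp add: O'_def conj_ac)
    show "open ((snd e \<circ> F) ` (O' \<inter> V))" if V: "openin (mtop M) V" for V
    proof -
      have "(snd e \<circ> F) ` (O' \<inter> V) = snd e ` (fst e \<inter> {q \<in> points N. G q \<in> V})" (is "?l = ?r")
      proof
        show "?l \<subseteq> ?r" using GF bij eN by (force simp: O'_def bij_betw_def)
        show "?r \<subseteq> ?l"
        proof clarify
          fix q assume q: "q \<in> fst e" "q \<in> points N" "G q \<in> V"
          then have "G q \<in> O' \<inter> V" "snd e q = (snd e \<circ> F) (G q)" using FG by (auto simp: O'_def)
          then show "snd e q \<in> (snd e \<circ> F) ` (O' \<inter> V)" by blast
        qed
      qed
      then show ?thesis
        using chart_open_image[OF ec smooth_map_openin_preimage[OF smG V]] by simp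
    qed
  qed
  \<comment> \<open>This identifies transitions out of the pulled-back chart with coordinate
    expressions of the inverse \<open>G\<close>.\<close>
  have ci: "cinv ?c x = G (cinv e x)" if x: "x \<in> cimage e" for x
  proof -
    have q: "cinv e x \<in> fst e" "snd e (cinv e x) = x" using cinv_in[OF x] chart_cinv[OF x] by simp_all
    then have "G (cinv e x) \<in> O'" "snd ?c (G (cinv e x)) = x" using FG eN by (auto simp: O'_def)
    then show ?thesis using cinv_chart[OF ch, of "G (cinv e x)"] by simp
  qed
  have "smooth_transition ?c d" "smooth_transition d ?c" if d: "d \<in> atlas M" for d
  proof -
    have dc: "is_chart (mtop M) d" using M d by (auto simp: smooth_atlas_def)
    have dt: "smooth_transition d d'" "smooth_transition d' d" if "d' \<in> charts M" for d'
      using that d by (auto simp: charts_def compatible_iff)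
    have eq: "snd ?c ` (fst ?c \<inter> fst d) = snd e ` {q \<in> fst e. G q \<in> fst d}" (is "?l = ?r")
    proof
      show "?l \<subseteq> ?r" using GF by (force simp: O'_def)
      show "?r \<subseteq> ?l"
      proof clarify
        fix q assume q: "q \<in> fst e" "G q \<in> fst d"
        then have "G q \<in> fst ?c \<inter> fst d" "snd e q = snd ?c (G q)" using FG eN by (auto simp: O'_def)
        then show "snd e q \<in> snd ?c ` (fst ?c \<inter> fst d)" by blast
      qed
    qed
    have "smooth_on (snd e ` {q \<in> fst e. G q \<in> fst d}) (snd d \<circ> G \<circ> cinv e)"
      using et dt by (intro smooth_map_coordinates[OF fd fdM smG ec _ dc]) auto
    then have "smooth_on (snd ?c ` (fst ?c \<inter> fst d)) (snd d \<circ> cinv ?c)"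
      unfolding eq
    proof (rule smooth_on_cong)
      show "open (snd e ` {q \<in> fst e. G q \<in> fst d})"
        using chart_open_image[OF ch chart_openin[OF dc]] eq by simp
    qed (auto simp: ci cimage_def)
    then show "smooth_transition ?c d" unfolding smooth_transition_def .
    have "smooth_on (snd d ` {p \<in> fst d. F p \<in> fst e}) (snd e \<circ> F \<circ> cinv d)"
      using et dt by (intro smooth_map_coordinates[OF fdM fd smF dc _ ec]) auto
    moreover have "{p \<in> fst d. F p \<in> fst e} = fst d \<inter> fst ?c"
      using is_chart_points[OF dc] by (auto simp: O'_def)
    ultimately show "smooth_transition d ?c"
      by (simp add: smooth_transition_def)
  qed
  then show ?thesis using ch by (simp add: model_charts_def O'_def)
qed

section \<open>Restriction of charts to open sets, and products of charts\<close>

lemma is_chart_open_subtopology: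
  assumes W: "openin X W"
  shows "is_chart (subtopology X W) c \<longleftrightarrow> is_chart X c \<and> fst c \<subseteq> W"
proof
  assume L: "is_chart (subtopology X W) c"
  then have c: "fst c \<subseteq> W" by (auto simp: is_chart_iff openin_open_subtopology[OF W])
  have "open (snd c ` (fst c \<inter> V))" if "openin X V" for V
  proof -
    have "openin (subtopology X W) (V \<inter> W)"
      using that W by (auto simp: openin_open_subtopology)
    moreover have "fst c \<inter> (V \<inter> W) = fst c \<inter> V" using c by auto
    ultimately show ?thesis using chart_open_image[OF L, of "V \<inter> W"] by simp
  qed
  with L c show "is_chart X c \<and> fst c \<subseteq> W"
    by (auto simp: is_chart_iff openin_open_subtopology[OF W])
next
  assume "is_chart X c \<and> fst c \<subseteq> W"
  then show "is_chart (subtopology X W) c"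
    by (auto simp: is_chart_iff openin_open_subtopology[OF W])
qed

lemma is_chart_restrict:
  assumes c: "is_chart X c" and W: "openin X W"
  shows "is_chart X (fst c \<inter> W, snd c)"
proof -
  have "openin X {p \<in> fst c \<inter> W. snd c p \<in> G}" if "open G" for G
  proof -
    have "{p \<in> fst c \<inter> W. snd c p \<in> G} = {p \<in> fst c. snd c p \<in> G} \<inter> W" by auto
    then show ?thesis using chart_openin_preimage[OF c that] W by auto
  qed
  then show ?thesis
    using c W chart_open_image[OF c openin_Int[OF W]]
    by (auto simp: is_chart_iff inf_assoc intro: inj_on_subset)
qed

text \<open>\<open>cinv\<close> is an \<open>inv_into\<close> and so depends on the domain: after
  restriction it may be a different function, and agreement is guaranteed only at coordinates of
  points that remain.\<close>

lemma cinv_restrict: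
  assumes c: "is_chart X c" and p: "p \<in> fst c \<inter> W"
  shows "cinv (fst c \<inter> W, snd c) (snd c p) = p"
  using p chart_inj[OF c] unfolding cinv_def
  by (auto intro: inv_into_f_f inj_on_subset)

lemma smooth_transition_restrict:
  assumes c: "is_chart X c" and d: "is_chart X d" and W: "openin X W" "openin X W'"
    and cd: "smooth_transition c d"
  shows "smooth_transition (fst c \<inter> W, snd c) (fst d \<inter> W', snd d)"
  unfolding smooth_transition_def fst_conv snd_conv
proof (rule smooth_on_cong)
  show "smooth_on (snd c ` (fst c \<inter> W \<inter> (fst d \<inter> W'))) (snd d \<circ> cinv c)"
    using cd unfolding smooth_transition_def by (rule smooth_on_subset) auto
  show "open (snd c ` (fst c \<inter> W \<inter> (fst d \<inter> W')))"
    unfolding inf_assoc by (intro chart_open_image[OF c] openin_Int W chart_openin[OF d])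
qed (auto simp: cinv_restrict[OF c] cinv_chart[OF c])

lemma atlas_open_submanifold:
  "atlas (open_submanifold M W) = (\<lambda>c. (fst c \<inter> W, snd c)) ` atlas M"
  by (simp add: open_submanifold_def case_prod_unfold)

lemma smooth_atlas_open_submanifold:
  assumes M: "smooth_atlas M" and W: "openin (mtop M) W"
  shows "smooth_atlas (open_submanifold M W)"
proof -
  have "mtop (open_submanifold M W) = subtopology (mtop M) W" by (simp add: open_submanifold_def)
  then show ?thesis using M
    unfolding smooth_atlas_def atlas_open_submanifold
    by (auto simp: is_chart_open_subtopology[OF W] compatible_iff
        intro!: is_chart_restrict W smooth_transition_restrict)
qed

text \<open>A chart living inside \<open>W\<close> meets an atlas chart of \<open>M\<close> only
  inside \<open>W\<close>, so its overlaps are those with the restricted atlas.\<close>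

lemma model_charts_open_submanifold:
  assumes M: "smooth_atlas M" and W: "openin (mtop M) W"
    and c: "c \<in> model_charts (open_submanifold M W)"
  shows "c \<in> model_charts M"
proof -
  have cc: "is_chart (mtop M) c" and cW: "fst c \<subseteq> W"
    using c is_chart_open_subtopology[OF W, of c]
    by (auto simp: model_charts_def open_submanifold_def)
  have "smooth_transition c d" "smooth_transition d c" if d: "d \<in> atlas M" for d
  proof -
    let ?d = "(fst d \<inter> W, snd d)"
    have dc: "is_chart (mtop M) d" using M d by (auto simp: smooth_atlas_def)
    have tr: "smooth_transition c ?d" "smooth_transition ?d c"
      using c d by (auto simp: model_charts_def atlas_open_submanifold)
    have "fst c \<inter> (fst d \<inter> W) = fst c \<inter> fst d" using cW by auto
    then show "smooth_transition c d" using tr(1) by (simp add: smooth_transition_def)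
    have "fst d \<inter> W \<inter> fst c = fst d \<inter> fst c" using cW by auto
    then have "smooth_on (snd d ` (fst d \<inter> fst c)) (snd c \<circ> cinv ?d)"
      using tr(2) by (simp add: smooth_transition_def)
    moreover have "open (snd d ` (fst d \<inter> fst c))"
      by (rule chart_open_image[OF dc chart_openin[OF cc]])
    ultimately show "smooth_transition d c" unfolding smooth_transition_def
      by (rule smooth_on_cong) (use cW in \<open>auto simp: cinv_restrict[OF dc] cinv_chart[OF dc]\<close>)
  qed
  with cc show ?thesis by (simp add: model_charts_def)
qed

lemma is_chart_prod:
  assumes c: "is_chart X c" and d: "is_chart Y d"
  shows "is_chart (prod_topology X Y) (fst c \<times> fst d, map_prod (snd c) (snd d))"
  unfolding is_chart_iff fst_conv snd_conv
proof (intro conjI allI impI)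
  show "openin (prod_topology X Y) (fst c \<times> fst d)"
    using chart_openin[OF c] chart_openin[OF d] by (simp add: openin_prod_Times_iff)
  show "inj_on (map_prod (snd c) (snd d)) (fst c \<times> fst d)"
    using chart_inj[OF c] chart_inj[OF d] by (rule map_prod_inj_on)
  show "openin (prod_topology X Y) {p \<in> fst c \<times> fst d. map_prod (snd c) (snd d) p \<in> G}"
    if G: "open G" for G
    unfolding openin_prod_topology_alt
  proof (intro allI impI)
    fix x y assume "(x, y) \<in> {p \<in> fst c \<times> fst d. map_prod (snd c) (snd d) p \<in> G}"
    then have xy: "x \<in> fst c" "y \<in> fst d" "(snd c x, snd d y) \<in> G" by auto
    obtain G1 G2 where g: "open G1" "open G2" "(snd c x, snd d y) \<in> G1 \<times> G2" "G1 \<times> G2 \<subseteq> G"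
      by (rule open_prod_elim[OF G xy(3)])
    have "openin X {p \<in> fst c. snd c p \<in> G1}" "openin Y {p \<in> fst d. snd d p \<in> G2}"
      using chart_openin_preimage[OF c g(1)] chart_openin_preimage[OF d g(2)] by simp_all
    moreover have "x \<in> {p \<in> fst c. snd c p \<in> G1}" "y \<in> {p \<in> fst d. snd d p \<in> G2}"
      using xy g by auto
    moreover have "{p \<in> fst c. snd c p \<in> G1} \<times> {p \<in> fst d. snd d p \<in> G2}
        \<subseteq> {p \<in> fst c \<times> fst d. map_prod (snd c) (snd d) p \<in> G}" using g by auto
    ultimately show "\<exists>U V. openin X U \<and> openin Y V \<and> x \<in> U \<and> y \<in> V \<and>
        U \<times> V \<subseteq> {p \<in> fst c \<times> fst d. map_prod (snd c) (snd d) p \<in> G}" by blast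
  qed
  show "open (map_prod (snd c) (snd d) ` (fst c \<times> fst d \<inter> V))"
    if V: "openin (prod_topology X Y) V" for V
  proof (subst open_prod_def, intro ballI)
    fix z assume "z \<in> map_prod (snd c) (snd d) ` (fst c \<times> fst d \<inter> V)"
    then obtain x y where xy: "z = (snd c x, snd d y)" "x \<in> fst c" "y \<in> fst d" "(x, y) \<in> V" by auto
    obtain V1 V2 where v: "openin X V1" "openin Y V2" "x \<in> V1" "y \<in> V2" "V1 \<times> V2 \<subseteq> V"
      using V[unfolded openin_prod_topology_alt, rule_format, OF xy(4)] by (elim exE conjE)
    have "open (snd c ` (fst c \<inter> V1))" "open (snd d ` (fst d \<inter> V2))"
      using chart_open_image[OF c v(1)] chart_open_image[OF d v(2)] by simp_all
    moreover have "z \<in> snd c ` (fst c \<inter> V1) \<times> snd d ` (fst d \<inter> V2)" using xy v by auto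
    moreover have "snd c ` (fst c \<inter> V1) \<times> snd d ` (fst d \<inter> V2)
        \<subseteq> map_prod (snd c) (snd d) ` (fst c \<times> fst d \<inter> V)"
      unfolding map_prod_image[symmetric] using v(5) by (intro image_mono) auto
    ultimately show "\<exists>G1 G2. open G1 \<and> open G2 \<and> z \<in> G1 \<times> G2 \<and>
        G1 \<times> G2 \<subseteq> map_prod (snd c) (snd d) ` (fst c \<times> fst d \<inter> V)" by blast
  qed
qed

section \<open>Submanifolds\<close>

lemma linear_inv_into_subspace:
  assumes A: "linear A" and L: "subspace L" and bij: "bij_betw A L UNIV"
  shows "linear (inv_into L A)"
proof -
  let ?G = "inv_into L A"
  have AG: "A (?G y) = y" "?G y \<in> L" for y
    using bij by (auto simp: bij_betw_def f_inv_into_f inv_into_into)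
  have eq: "x = y" if "A x = A y" "x \<in> L" "y \<in> L" for x y
    using bij that by (auto simp: bij_betw_def inj_on_def)
  show ?thesis
  proof (rule linearI)
    show "?G (x + y) = ?G x + ?G y" for x y
      by (rule eq) (auto simp: AG linear_add[OF A] intro: subspace_add[OF L])
    show "?G (r *\<^sub>R x) = r *\<^sub>R ?G x" for r x
      by (rule eq) (auto simp: AG linear_cmul[OF A] intro: subspace_scale[OF L])
  qed
qed

text \<open>\<open>G\<close> is the inverse of the restriction of \<open>A\<close> to the subspace cut out by the slice chart.\<close>

lemma submanifold_chartE:
  fixes M :: "('a, 'e::real_inner) manifold" and c :: "('a, 'f::real_inner) chart"
  assumes fd: "finite_dim TYPE('e)" "finite_dim TYPE('f)" and c: "c \<in> atlas (submanifold M N)"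
  obtains C A G where "C \<in> charts M" "c = (fst C \<inter> N, A \<circ> snd C)"
    "bounded_linear A" "bounded_linear G" "\<And>y. A (G y) = y"
    "\<And>p. p \<in> fst C \<inter> N \<Longrightarrow> G (A (snd C p)) = snd C p"
    "\<And>q y. q \<in> fst C \<Longrightarrow> snd C q = G y \<Longrightarrow> q \<in> N"
proof -
  obtain U \<phi> A L where c: "c = (U \<inter> N, A \<circ> \<phi>)" and C: "(U, \<phi>) \<in> charts M" and A: "linear A"
    and L: "subspace L" "bij_betw A L UNIV" "\<phi> ` (U \<inter> N) = \<phi> ` U \<inter> L"
    using c by (auto simp: submanifold_def)
  let ?G = "inv_into L A"
  have inj: "inj_on \<phi> U" using C chart_inj[of _ "(U, \<phi>)"] by (auto simp: charts_def)
  have AG: "A (?G y) = y" "?G y \<in> L" for y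
    using L(2) by (auto simp: bij_betw_def f_inv_into_f inv_into_into)
  show ?thesis
  proof (rule that[of "(U, \<phi>)" A ?G])
    show "bounded_linear A" "bounded_linear ?G"
      using finite_dim_bounded_linear fd A linear_inv_into_subspace[OF A L(1,2)] by blast+
    show "?G (A (snd (U, \<phi>) p)) = snd (U, \<phi>) p" if "p \<in> fst (U, \<phi>) \<inter> N" for p
    proof -
      have "\<phi> p \<in> L" using that L(3) by auto
      then show ?thesis using L(2) by (simp add: bij_betw_def)
    qed
    show "q \<in> N" if "q \<in> fst (U, \<phi>)" "snd (U, \<phi>) q = ?G y" for q y
    proof -
      have "\<phi> q \<in> \<phi> ` U" using that(1) by (intro imageI) simp
      moreover have "\<phi> q \<in> L" using that(2) AG(2)[of y] by simp
      ultimately have "\<phi> q \<in> \<phi> ` (U \<inter> N)" using L(3) by blast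
      then show ?thesis using inj that(1) by (auto dest: inj_onD)
    qed
  qed (use c C AG in auto)
qed

text \<open>The inverse of a slice chart is the inverse of the ambient chart composed with the
  linear map \<open>G\<close>. A transition between slice charts is therefore an ambient transition
  between two bounded linear maps,
  \<open>A' \<circ> (snd D \<circ> cinv C) \<circ> G\<close>.\<close>

lemma smooth_atlas_submanifold:
  fixes M :: "('a, 'e::real_inner) manifold"
  assumes M: "smooth_manifold M" and fd: "finite_dim TYPE('f::real_inner)"
  shows "smooth_atlas (submanifold M N :: ('a, 'f) manifold)"
proof -
  let ?N = "submanifold M N :: ('a, 'f) manifold"
  have mt: "mtop ?N = subtopology (mtop M) N" by (simp add: submanifold_def)
  have fde: "finite_dim TYPE('e)" using smooth_manifold_smooth_atlas[OF M] by (simp add: smooth_atlas_def)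
  have ch: "is_chart (mtop ?N) c" if c: "c \<in> atlas ?N" for c
  proof (rule submanifold_chartE[OF fde fd c])
    fix C :: "('a, 'e) chart" and A :: "'e \<Rightarrow> 'f" and G :: "'f \<Rightarrow> 'e"
    assume C: "C \<in> charts M" and c: "c = (fst C \<inter> N, A \<circ> snd C)"
      and A: "bounded_linear A" and G: "bounded_linear G" and AG: "\<And>y. A (G y) = y"
      and GA: "\<And>p. p \<in> fst C \<inter> N \<Longrightarrow> G (A (snd C p)) = snd C p"
      and GN: "\<And>q y. q \<in> fst C \<Longrightarrow> snd C q = G y \<Longrightarrow> q \<in> N"
    have Cc: "is_chart (mtop M) C" using C by (simp add: charts_def)
    show ?thesis unfolding is_chart_iff c fst_conv snd_conv mt
    proof (intro conjI allI impI)
      show "openin (subtopology (mtop M) N) (fst C \<inter> N)"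
        by (intro openin_subtopology_Int chart_openin[OF Cc])
      show "inj_on (A \<circ> snd C) (fst C \<inter> N)"
      proof (rule inj_onI)
        fix p q assume pq: "p \<in> fst C \<inter> N" "q \<in> fst C \<inter> N" "(A \<circ> snd C) p = (A \<circ> snd C) q"
        have "snd C p = G (A (snd C p))" by (rule GA[OF pq(1), symmetric])
        also have "\<dots> = G (A (snd C q))" using pq(3) by simp
        also have "\<dots> = snd C q" by (rule GA[OF pq(2)])
        finally have "snd C p = snd C q" .
        then show "p = q" using chart_inj[OF Cc] pq by (auto dest: inj_onD)
      qed
      show "openin (subtopology (mtop M) N) {p \<in> fst C \<inter> N. (A \<circ> snd C) p \<in> H}" if "open H" for H
      proof -
        have "open (A -` H)"
          using that A by (intro open_vimage linear_continuous_on)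
        from chart_openin_preimage[OF Cc this]
        have "openin (subtopology (mtop M) N) ({p \<in> fst C. snd C p \<in> A -` H} \<inter> N)"
          by (rule openin_subtopology_Int)
        moreover have "{p \<in> fst C. snd C p \<in> A -` H} \<inter> N = {p \<in> fst C \<inter> N. (A \<circ> snd C) p \<in> H}" by auto
        ultimately show ?thesis by simp
      qed
      show "open ((A \<circ> snd C) ` (fst C \<inter> N \<inter> V))" if V: "openin (subtopology (mtop M) N) V" for V
      proof -
        obtain V' where V': "openin (mtop M) V'" "V = V' \<inter> N"
          using V unfolding openin_subtopology by blast
        \<comment> \<open>In coordinates the slice lies in the range of \<open>G\<close>, so an
          image under \<open>A\<close> can be rewritten as a preimage under the continuous map
          \<open>G\<close>, whose openness is immediate.\<close>
        have "(A \<circ> snd C) ` (fst C \<inter> N \<inter> V) = G -` (snd C ` (fst C \<inter> V'))" (is "?l = ?r")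
        proof
          show "?l \<subseteq> ?r" using GA V'(2) by auto
          show "?r \<subseteq> ?l"
          proof
            fix y assume "y \<in> ?r"
            then obtain q where q: "q \<in> fst C" "q \<in> V'" "snd C q = G y" by auto
            then have "q \<in> fst C \<inter> N \<inter> V" "y = (A \<circ> snd C) q" using GN[OF q(1,3)] V'(2) AG by auto
            then show "y \<in> ?l" by blast
          qed
        qed
        then show ?thesis
          using open_vimage[OF chart_open_image[OF Cc V'(1)] linear_continuous_on[OF G]] by simp
      qed
    qed
  qed
  have tr: "smooth_transition c d" if c: "c \<in> atlas ?N" and d: "d \<in> atlas ?N" for c d
  proof (rule submanifold_chartE[OF fde fd c], rule submanifold_chartE[OF fde fd d])
    fix C D :: "('a, 'e) chart" and A A' :: "'e \<Rightarrow> 'f" and G G' :: "'f \<Rightarrow> 'e"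
    assume C: "C \<in> charts M" and ceq: "c = (fst C \<inter> N, A \<circ> snd C)" and G: "bounded_linear G"
      and GA: "\<And>p. p \<in> fst C \<inter> N \<Longrightarrow> G (A (snd C p)) = snd C p"
      and D: "D \<in> charts M" and deq: "d = (fst D \<inter> N, A' \<circ> snd D)" and A': "bounded_linear A'"
    let ?V = "snd c ` (fst c \<inter> fst d)"
    have Cc: "is_chart (mtop M) C" using C by (simp add: charts_def)
    have op: "open ?V" by (rule chart_open_image[OF ch[OF c] chart_openin[OF ch[OF d]]])
    have t: "smooth_on (snd C ` (fst C \<inter> fst D)) (snd D \<circ> cinv C)"
      using model_charts_smooth_transition[OF M, of C D] C D
      by (simp add: charts_eq_model_charts smooth_transition_def)
    have "smooth_on ?V ((snd D \<circ> cinv C) \<circ> G)"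
      by (rule smooth_on_compose[OF fde op _ smooth_on_bounded_linear[OF op G] t])
        (auto simp: ceq deq GA)
    then have "smooth_on ?V (A' \<circ> ((snd D \<circ> cinv C) \<circ> G))"
      by (rule smooth_on_compose[OF fde op _ _ smooth_on_bounded_linear[OF open_UNIV A'], rotated]) simp
    then show "smooth_transition c d" unfolding smooth_transition_def
    proof (rule smooth_on_cong[OF _ op])
      fix x assume "x \<in> ?V"
      then obtain p where p: "p \<in> fst c" "p \<in> fst d" "x = snd c p" by auto
      have "cinv c x = p" using cinv_chart[OF ch[OF c] p(1)] p(3) by simp
      moreover have "cinv C (G x) = p" using p by (simp add: ceq GA cinv_chart[OF Cc])
      ultimately show "(A' \<circ> ((snd D \<circ> cinv C) \<circ> G)) x = (snd d \<circ> cinv c) x" by (simp add: deq)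
    qed
  qed
  show ?thesis using fd ch tr by (auto simp: smooth_atlas_def compatible_iff)
qed

section \<open>Derivatives in coordinates and tangent spaces\<close>

text \<open>The chain rule for a change of charts on both sides, at a single point. The assumption
  \<open>ev\<close> makes the composite through \<open>d\<close> equal to the new coordinate
  expression on a neighbourhood, not just at the point.\<close>

lemma has_derivative_coordinates:
  assumes c: "is_chart X c" and c': "is_chart X c'" and d: "is_chart Y d"
    and p: "p \<in> fst c" "p \<in> fst c'" and fp: "f p \<in> fst d"
    and f: "(snd d \<circ> f \<circ> cinv c has_derivative Df) (at (snd c p))"
    and ev: "\<forall>\<^sub>F x in nhds (snd c p). f (cinv c x) \<in> fst d"
    and C: "(snd c \<circ> cinv c' has_derivative C) (at (snd c' p))"
    and E: "(snd d' \<circ> cinv d has_derivative E) (at (snd d (f p)))"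
  shows "(snd d' \<circ> f \<circ> cinv c' has_derivative (\<lambda>v. E (Df (C v)))) (at (snd c' p))"
proof -
  let ?g = "snd c \<circ> cinv c'" and ?x = "snd c' p"
  have gx: "?g ?x = snd c p" using cinv_chart[OF c' p(2)] by simp
  have fx: "(snd d \<circ> f \<circ> cinv c) (snd c p) = snd d (f p)" using cinv_chart[OF c p(1)] by simp
  have "((\<lambda>x. (snd d \<circ> f \<circ> cinv c) (?g x)) has_derivative (\<lambda>v. Df (C v))) (at ?x)"
    by (rule has_derivative_compose[OF C]) (simp only: gx f)
  then have *: "((\<lambda>x. (snd d' \<circ> cinv d) ((snd d \<circ> f \<circ> cinv c) (?g x))) has_derivative
      (\<lambda>v. E (Df (C v)))) (at ?x)"
    by (rule has_derivative_compose) (simp only: gx fx E)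
  have op: "open (snd c' ` (fst c' \<inter> fst c))" by (rule chart_open_image[OF c' chart_openin[OF c]])
  have near: "\<forall>\<^sub>F x in nhds ?x. x \<in> snd c' ` (fst c' \<inter> fst c)"
    using eventually_nhds_in_open[OF op] p by blast
  \<comment> \<open>The change of charts is known to be differentiable only at \<open>?x\<close>;
    the resulting continuity there is enough to carry \<open>ev\<close> over to the coordinates of
    \<open>c'\<close>.\<close>
  have "(?g \<longlongrightarrow> ?g ?x) (at ?x)"
    using has_derivative_continuous[OF C] unfolding continuous_within .
  then have "(?g \<longlongrightarrow> ?g ?x) (nhds ?x)" unfolding tendsto_at_iff_tendsto_nhds .
  then have "(?g \<longlongrightarrow> snd c p) (nhds ?x)" unfolding gx .
  then have "\<forall>\<^sub>F x in nhds ?x. f (cinv c (?g x)) \<in> fst d"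
    by (rule eventually_compose_filterlim[OF ev])
  with near have eq: "\<forall>\<^sub>F x in nhds ?x.
      (snd d' \<circ> cinv d) ((snd d \<circ> f \<circ> cinv c) (?g x)) = (snd d' \<circ> f \<circ> cinv c') x"
  proof eventually_elim
    case (elim x)
    then obtain q where q: "q \<in> fst c'" "q \<in> fst c" "x = snd c' q" by auto
    then have "f q \<in> fst d" using elim by (simp add: cinv_chart[OF c'] cinv_chart[OF c])
    then show ?case using q by (simp add: cinv_chart[OF c'] cinv_chart[OF c] cinv_chart[OF d])
  qed
  show ?thesis
  proof (rule has_derivative_transform_eventually[OF *])
    show "\<forall>\<^sub>F x in at ?x. (snd d' \<circ> cinv d) ((snd d \<circ> f \<circ> cinv c) (?g x)) = (snd d' \<circ> f \<circ> cinv c') x"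
      using eq by (auto simp: eventually_nhds_conv_at)
  qed (use eventually_nhds_x_imp_x[OF eq] in auto)
qed

definition transition_deriv ::
    "('a, 'e::real_inner) chart \<Rightarrow> ('a, 'f::real_inner) chart \<Rightarrow> 'a \<Rightarrow> 'e \<Rightarrow> 'f" where
  "transition_deriv c d p = frechet_derivative (snd d \<circ> cinv c) (at (snd c p))"

lemma has_derivative_transition_trans:
  assumes c: "is_chart X c" and d: "is_chart X d" and p: "p \<in> fst c" "p \<in> fst d"
    and cd: "(snd d \<circ> cinv c has_derivative C) (at (snd c p))"
    and de: "(snd e \<circ> cinv d has_derivative D) (at (snd d p))"
  shows "(snd e \<circ> cinv c has_derivative (\<lambda>v. D (C v))) (at (snd c p))"
proof -
  have op: "open (cimage d)" by (rule chart_open_cimage[OF d])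
  have ev: "\<forall>\<^sub>F x in nhds (snd d p). cinv d x \<in> fst d"
    using eventually_nhds_in_open[OF op, of "snd d p"] p
    by (auto simp: cimage_def elim!: eventually_mono intro!: cinv_in[unfolded cimage_def])
  have "(snd d \<circ> (\<lambda>q. q) \<circ> cinv d has_derivative (\<lambda>v. v)) (at (snd d p))"
    by (rule has_derivative_transform_within_open[OF has_derivative_ident op])
      (use p in \<open>auto simp: cimage_def cinv_chart[OF d]\<close>)
  from has_derivative_coordinates[OF d c d p(2,1) p(2) this ev cd de]
  show ?thesis by (simp add: o_def)
qed

lemma has_derivative_transition_refl:
  assumes c: "is_chart X c" and p: "p \<in> fst c"
  shows "(snd c \<circ> cinv c has_derivative (\<lambda>v. v)) (at (snd c p))"
  by (rule has_derivative_transform_within_open[OF has_derivative_ident chart_open_cimage[OF c]])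
      (use p in \<open>auto simp: cimage_def cinv_chart[OF c]\<close>)

lemma smooth_transition_has_derivative:
  assumes "smooth_transition c d" "p \<in> fst c" "p \<in> fst d"
  shows "(snd d \<circ> cinv c has_derivative transition_deriv c d p) (at (snd c p))"
  using assms unfolding smooth_transition_def transition_deriv_def
  by (intro smooth_on_has_derivative) auto

text \<open>The condition, at the single point \<open>p\<close>, under which the tangent space
  behaves as expected. Being pointwise, it follows for a fiber as soon as one slice chart through
  \<open>p\<close> is exhibited.\<close>

definition tangent_regular :: "('a, 'e::real_inner) manifold \<Rightarrow> 'a \<Rightarrow> bool" where
  "tangent_regular M p \<longleftrightarrow> charts_at M p \<noteq> {} \<and> (\<forall>c\<in>charts_at M p. \<forall>d\<in>charts_at M p.
     (snd d \<circ> cinv c has_derivative transition_deriv c d p) (at (snd c p)))"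

text \<open>Members of \<open>charts_at M p\<close> are compatible with atlas charts by definition,
  but not with each other. The atlas chart \<open>e\<close> through \<open>p\<close> mediates
  between any two of them.\<close>

lemma smooth_atlas_tangent_regular:
  assumes M: "smooth_atlas M" and e: "e \<in> atlas M" "p \<in> fst e"
  shows "tangent_regular M p"
proof -
  have "e \<in> charts_at M p" using e atlas_subset_charts[OF M] by (auto simp: charts_at_def)
  moreover have "(snd d \<circ> cinv c has_derivative transition_deriv c d p) (at (snd c p))"
    if "c \<in> charts_at M p" "d \<in> charts_at M p" for c d
  proof -
    have "smooth_on (snd c ` (fst c \<inter> (fst d \<inter> fst e))) (snd d \<circ> cinv c)"
      using M e that by (intro smooth_on_transition_near[OF _ _ _ e(1)])
        (auto simp: smooth_atlas_def charts_at_def charts_eq_model_charts)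
    then show ?thesis unfolding transition_deriv_def
      using e that by (intro smooth_on_has_derivative) (auto simp: charts_at_def)
  qed
  ultimately show ?thesis unfolding tangent_regular_def by blast
qed

lemma smooth_manifold_tangent_regular:
  "smooth_manifold M \<Longrightarrow> p \<in> points M \<Longrightarrow> tangent_regular M p"
  by (metis smooth_manifold_chart_at smooth_manifold_smooth_atlas smooth_atlas_tangent_regular)

lemma charts_atD: "c \<in> charts_at M p \<Longrightarrow> is_chart (mtop M) c \<and> p \<in> fst c"
  by (simp add: charts_at_def charts_def)

lemma transition_deriv_trans:
  assumes M: "tangent_regular M p"
    and c: "c \<in> charts_at M p" and d: "d \<in> charts_at M p" and e: "e \<in> charts_at M p"
  shows "transition_deriv d e p (transition_deriv c d p v) = transition_deriv c e p v"
proof -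
  have "(snd e \<circ> cinv c has_derivative (\<lambda>v. transition_deriv d e p (transition_deriv c d p v)))
      (at (snd c p))"
  proof (rule has_derivative_transition_trans[where X = "mtop M"
        and C = "transition_deriv c d p" and D = "transition_deriv d e p"])
    show "(snd d \<circ> cinv c has_derivative transition_deriv c d p) (at (snd c p))"
      "(snd e \<circ> cinv d has_derivative transition_deriv d e p) (at (snd d p))"
      using M c d e unfolding tangent_regular_def by blast+
  qed (use charts_atD[OF c] charts_atD[OF d] in simp_all)
  moreover have "(snd e \<circ> cinv c has_derivative transition_deriv c e p) (at (snd c p))"
    using M c e unfolding tangent_regular_def by blast
  ultimately have "(\<lambda>v. transition_deriv d e p (transition_deriv c d p v)) = transition_deriv c e p"
    by (rule has_derivative_unique)
  then show ?thesis by (rule fun_cong)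
qed

lemma transition_deriv_refl:
  assumes "c \<in> charts_at M p"
  shows "transition_deriv c c p v = v"
proof -
  have "(\<lambda>v. v) = transition_deriv c c p" unfolding transition_deriv_def
    using charts_atD[OF assms] by (intro frechet_derivative_at has_derivative_transition_refl) auto
  then show ?thesis by (rule fun_cong[symmetric])
qed

lemma tangent_space_iff:
  "v \<in> tangent_space M p \<longleftrightarrow> v \<in> extensional (charts_at M p) \<and>
     (\<forall>c\<in>charts_at M p. \<forall>d\<in>charts_at M p. v d = transition_deriv c d p (v c))"
  by (simp add: tangent_space_def transition_deriv_def)

lemma tangent_space_component:
  "v \<in> tangent_space M p \<Longrightarrow> c \<in> charts_at M p \<Longrightarrow> d \<in> charts_at M p \<Longrightarrow>
     v d = transition_deriv c d p (v c)"
  unfolding tangent_space_iff by blast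

text \<open>One component determines the others through the transition derivatives, and
  extensionality fixes the family elsewhere. Conversely any vector of the model space spreads to a
  consistent family by the cocycle rule \<open>transition_deriv_trans\<close>.\<close>

lemma bij_betw_tangent_component:
  assumes M: "tangent_regular M p" and c: "c \<in> charts_at M p"
  shows "bij_betw (\<lambda>v. v c) (tangent_space M p) UNIV"
  unfolding bij_betw_def
proof
  show "inj_on (\<lambda>v. v c) (tangent_space M p)"
  proof (rule inj_onI)
    fix v w assume vw: "v \<in> tangent_space M p" "w \<in> tangent_space M p" "v c = w c"
    show "v = w"
    proof (rule extensionalityI)
      show "v \<in> extensional (charts_at M p)" "w \<in> extensional (charts_at M p)"
        using vw unfolding tangent_space_iff by blast+
      show "v d = w d" if "d \<in> charts_at M p" for d
        using tangent_space_component[OF vw(1) c that] tangent_space_component[OF vw(2) c that] vw(3)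
        by simp
    qed
  qed
  show "(\<lambda>v. v c) ` tangent_space M p = UNIV"
  proof (intro equalityI subsetI UNIV_I)
    fix x
    let ?v = "\<lambda>d\<in>charts_at M p. transition_deriv c d p x"
    have "?v \<in> tangent_space M p"
      using transition_deriv_trans[OF M c] by (auto simp: tangent_space_iff)
    then have "(\<lambda>v. v c) ?v \<in> (\<lambda>v. v c) ` tangent_space M p" by (rule imageI)
    then show "x \<in> (\<lambda>v. v c) ` tangent_space M p" using transition_deriv_refl[OF c] c by simp
  qed
qed

text \<open>\<open>tangent_map\<close> is defined through an unspecified chart at \<open>p\<close>.
  Here it becomes computable in any pair \<open>c\<close>, \<open>d\<close> in which the derivative
  of \<open>f\<close> at that point is known; differentiability there and \<open>ev\<close> replace
  smoothness of \<open>f\<close> as a map of manifolds.\<close>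

lemma tangent_map_component:
  assumes M: "tangent_regular M p" and N: "tangent_regular N (f p)"
    and c: "c \<in> charts_at M p" and d: "d \<in> charts_at N (f p)"
    and f: "(snd d \<circ> f \<circ> cinv c has_derivative Df) (at (snd c p))"
    and ev: "\<forall>\<^sub>F x in nhds (snd c p). f (cinv c x) \<in> fst d"
    and v: "v \<in> tangent_space M p"
  shows "tangent_map M N f p v \<in> tangent_space N (f p)" "tangent_map M N f p v d = Df (v c)"
proof -
  define c0 where "c0 = (SOME c. c \<in> charts_at M p)"
  have c0: "c0 \<in> charts_at M p" unfolding c0_def using c by (rule someI)
  have tm: "tangent_map M N f p v =
      (\<lambda>d'\<in>charts_at N (f p). transition_deriv d d' (f p) (Df (v c)))"
    unfolding tangent_map_def Let_def c0_def[symmetric]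
  proof (rule restrict_ext)
    fix d' assume d': "d' \<in> charts_at N (f p)"
    have "(snd d' \<circ> f \<circ> cinv c0 has_derivative
        (\<lambda>v. transition_deriv d d' (f p) (Df (transition_deriv c0 c p v)))) (at (snd c0 p))"
    proof (rule has_derivative_coordinates[where X = "mtop M" and Y = "mtop N"
          and C = "transition_deriv c0 c p" and E = "transition_deriv d d' (f p)", OF _ _ _ _ _ _ f ev])
      show "(snd c \<circ> cinv c0 has_derivative transition_deriv c0 c p) (at (snd c0 p))"
        using M c c0 unfolding tangent_regular_def by blast
      show "(snd d' \<circ> cinv d has_derivative transition_deriv d d' (f p)) (at (snd d (f p)))"
        using N d d' unfolding tangent_regular_def by blast
    qed (use charts_atD[OF c] charts_atD[OF d] charts_atD[OF c0] in simp_all)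
    from fun_cong[OF frechet_derivative_at[OF this]]
    have "frechet_derivative (snd d' \<circ> f \<circ> cinv c0) (at (snd c0 p)) (v c0) =
        transition_deriv d d' (f p) (Df (transition_deriv c0 c p (v c0)))"
      by (rule sym)
    then show "frechet_derivative (snd d' \<circ> f \<circ> cinv c0) (at (snd c0 p)) (v c0) =
        transition_deriv d d' (f p) (Df (v c))"
      using tangent_space_component[OF v c0 c] by simp
  qed
  show "tangent_map M N f p v \<in> tangent_space N (f p)"
    using transition_deriv_trans[OF N d] by (auto simp: tangent_space_iff tm)
  show "tangent_map M N f p v d = Df (v c)"
    using transition_deriv_refl[OF d] d by (simp add: tm)
qed

text \<open>The derivatives at \<open>p\<close> of the two transitions between \<open>c\<close> and
  an atlas chart of \<open>M\<close> are mutually inverse. This relates model spaces that are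
  otherwise unrelated types.\<close>

lemma model_chart_linear_iso:
  fixes M :: "('a, 'e::real_inner) manifold" and c :: "('a, 'f::real_inner) chart"
  assumes M: "smooth_manifold M" and c: "c \<in> model_charts M" and p: "p \<in> fst c"
  obtains J :: "'f \<Rightarrow> 'e" and K where "bounded_linear J" "bounded_linear K"
    "\<And>x. K (J x) = x" "\<And>y. J (K y) = y"
proof -
  have cc: "is_chart (mtop M) c" using c by (rule is_chart_model_charts)
  then have "p \<in> points M" using p is_chart_points by blast
  then obtain d where d: "d \<in> atlas M" "p \<in> fst d" by (rule smooth_manifold_chart_at[OF M])
  have dc: "is_chart (mtop M) d"
    using d smooth_manifold_smooth_atlas[OF M] by (auto simp: smooth_atlas_def)
  have J: "(snd d \<circ> cinv c has_derivative transition_deriv c d p) (at (snd c p))"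
    and K: "(snd c \<circ> cinv d has_derivative transition_deriv d c p) (at (snd d p))"
    using c d p by (auto simp: model_charts_def intro: smooth_transition_has_derivative)
  show ?thesis
  proof (rule that)
    show "bounded_linear (transition_deriv c d p)" "bounded_linear (transition_deriv d c p)"
      using J K has_derivative_bounded_linear by blast+
    show "transition_deriv d c p (transition_deriv c d p x) = x" for x
      by (rule fun_cong[OF has_derivative_unique[OF has_derivative_transition_trans[OF cc dc p d(2) J K]
          has_derivative_transition_refl[OF cc p]]])
    show "transition_deriv c d p (transition_deriv d c p x) = x" for x
      by (rule fun_cong[OF has_derivative_unique[OF has_derivative_transition_trans[OF dc cc d(2) p K J]
          has_derivative_transition_refl[OF dc d(2)]]])
  qed
qed

section \<open>Adapted charts of a multi-fiber bundle\<close>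

definition adapted_chart ::
    "('m, 'em) manifold \<Rightarrow> ('m \<Rightarrow> 'b) \<Rightarrow> 'b set \<Rightarrow> ('m \<Rightarrow> 'b \<times> 's \<times> 'w) \<Rightarrow>
     ('b, 'eb) chart \<Rightarrow> ('s, 'es) chart \<Rightarrow> ('w, 'ew) chart \<Rightarrow> ('m, 'eb \<times> 'es \<times> 'ew) chart" where
  "adapted_chart M \<pi> U \<phi> a s w =
     ({p \<in> over M \<pi> U. \<phi> p \<in> fst a \<times> fst s \<times> fst w}, map_prod (snd a) (map_prod (snd s) (snd w)) \<circ> \<phi>)"

lemma points_open_submanifold: "points (open_submanifold M W) = points M \<inter> W"
  by (simp add: points_def open_submanifold_def)

lemma points_prod_manifold: "points (prod_manifold M N) = points M \<times> points N"
  by (simp add: points_def prod_manifold_def)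

lemma over_subset: "over M \<pi> U \<subseteq> points M"
  by (auto simp: over_def)

lemma openin_over:
  assumes "smooth_map M B \<pi>" "bundle_chart M B \<pi> S W U \<phi>"
  shows "openin (mtop M) (over M \<pi> U)"
  using smooth_map_openin_preimage[OF assms(1), of U] assms(2)
  by (simp add: over_def bundle_chart_def)

lemma bundle_chart_bij_betw:
  assumes b: "bundle_chart M B \<pi> S W U \<phi>"
  shows "bij_betw \<phi> (over M \<pi> U) (U \<times> points S \<times> points W)"
proof -
  have "U \<subseteq> points B" using b openin_subset unfolding bundle_chart_def points_def by blast
  then have "points B \<inter> U = U" "points M \<inter> over M \<pi> U = over M \<pi> U"
    using over_subset[of M \<pi> U] by blast+
  then show ?thesis using b
    by (simp add: bundle_chart_def diffeomorphism_def points_open_submanifold points_prod_manifold)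
qed

lemma bundle_chart_eq:
  "bundle_chart M B \<pi> S W U \<phi> \<Longrightarrow> p \<in> over M \<pi> U \<Longrightarrow> \<phi> p = (\<pi> p, hcomp \<phi> p, fcomp \<phi> p)"
  by (simp add: bundle_chart_def hcomp_def fcomp_def prod_eq_iff)

lemma mem_adapted_chart:
  assumes "bundle_chart M B \<pi> S W U \<phi>"
  shows "p \<in> fst (adapted_chart M \<pi> U \<phi> a s w) \<longleftrightarrow>
    p \<in> over M \<pi> U \<and> \<pi> p \<in> fst a \<and> hcomp \<phi> p \<in> fst s \<and> fcomp \<phi> p \<in> fst w"
  using bundle_chart_eq[OF assms, of p] by (auto simp: adapted_chart_def)

lemma adapted_chart_apply:
  assumes "bundle_chart M B \<pi> S W U \<phi>" "p \<in> over M \<pi> U"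
  shows "snd (adapted_chart M \<pi> U \<phi> a s w) p =
    (snd a (\<pi> p), snd s (hcomp \<phi> p), snd w (fcomp \<phi> p))"
  using bundle_chart_eq[OF assms] by (simp add: adapted_chart_def)

lemma smooth_manifold_finite_dim:
  "smooth_manifold (M :: ('a, 'e::real_inner) manifold) \<Longrightarrow> finite_dim TYPE('e)"
  using smooth_manifold_smooth_atlas smooth_atlas_def by blast

text \<open>A product chart of the trivial bundle over \<open>U\<close> is pulled back along the
  bundle chart to the open piece of \<open>M\<close> over \<open>U\<close>, and charts of an open
  piece are charts of \<open>M\<close>.\<close>

lemma adapted_chart_model_charts:
  fixes M :: "('m, 'em::real_inner) manifold" and B :: "('b, 'eb::real_inner) manifold"
    and S :: "('s, 'es::real_inner) manifold" and W :: "('w, 'ew::real_inner) manifold"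
  assumes M: "smooth_manifold M" and B: "smooth_manifold B"
    and S: "smooth_manifold S" and W: "smooth_manifold W"
    and \<pi>: "smooth_map M B \<pi>" and b: "bundle_chart M B \<pi> S W U \<phi>"
    and a: "a \<in> atlas B" and s: "s \<in> atlas S" and w: "w \<in> atlas W"
  shows "adapted_chart M \<pi> U \<phi> a s w \<in> model_charts M"
proof -
  let ?M = "open_submanifold M (over M \<pi> U)" and ?B = "open_submanifold B U"
  let ?P = "prod_manifold ?B (prod_manifold S W)"
  let ?e = "((fst a \<inter> U) \<times> fst s \<times> fst w, map_prod (snd a) (map_prod (snd s) (snd w)))"
  have U: "openin (mtop B) U" using b by (simp add: bundle_chart_def)
  have O': "openin (mtop M) (over M \<pi> U)" by (rule openin_over[OF \<pi> b])
  note atl = smooth_manifold_smooth_atlas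
  have aB: "(fst a \<inter> U, snd a) \<in> atlas ?B" using a by (auto simp: atlas_open_submanifold)
  then have ac: "is_chart (mtop ?B) (fst a \<inter> U, snd a)"
    using smooth_atlas_open_submanifold[OF atl[OF B] U] by (simp add: smooth_atlas_def)
  have sc: "is_chart (mtop S) s" and wc: "is_chart (mtop W) w"
    using s w atl[OF S] atl[OF W] by (simp_all add: smooth_atlas_def)
  have ec: "is_chart (mtop ?P) ?e"
    using is_chart_prod[OF ac is_chart_prod[OF sc wc]] by (simp add: prod_manifold_def)
  have e: "?e \<in> atlas ?P"
    using aB s w by (simp add: prod_manifold_def) (metis prod.collapse)
  have "({p \<in> points ?M. \<phi> p \<in> fst ?e}, snd ?e \<circ> \<phi>) \<in> model_charts ?M"
  proof (rule diffeomorphism_pullback_chart[OF _ _ _ ec])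
    show "smooth_atlas ?M" by (rule smooth_atlas_open_submanifold[OF atl[OF M] O'])
    show "finite_dim TYPE('eb \<times> 'es \<times> 'ew)"
      by (intro finite_dim_prod smooth_manifold_finite_dim[OF B] smooth_manifold_finite_dim[OF S]
          smooth_manifold_finite_dim[OF W])
    show "diffeomorphism ?M ?P \<phi>" using b by (simp add: bundle_chart_def)
    show "smooth_transition d ?e \<and> smooth_transition ?e d" if "d \<in> charts ?P" for d
      using that e by (auto simp: charts_def compatible_iff)
  qed
  then have "({p \<in> points ?M. \<phi> p \<in> fst ?e}, snd ?e \<circ> \<phi>) \<in> model_charts M"
    by (rule model_charts_open_submanifold[OF atl[OF M] O'])
  \<comment> \<open>Cutting \<open>a\<close> down to \<open>U\<close> leaves no trace: points over
    \<open>U\<close> have their projection in \<open>U\<close> anyway.\<close>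
  moreover have "({p \<in> points ?M. \<phi> p \<in> fst ?e}, snd ?e \<circ> \<phi>) = adapted_chart M \<pi> U \<phi> a s w"
    using over_subset[of M \<pi> U] bundle_chart_eq[OF b]
    by (auto simp: adapted_chart_def points_open_submanifold over_def)
  ultimately show ?thesis by simp
qed

text \<open>On \<open>A\<close> the map \<open>h\<close> is the inverse of \<open>g\<close> after
  \<open>f\<close>. It is applied to tangent maps, where \<open>f\<close> and \<open>g\<close> read
  off one coordinate component and are both bijections onto the model space.\<close>

lemma bij_betw_factor:
  assumes f: "bij_betw f A C" and g: "bij_betw g B C"
    and h: "\<And>x. x \<in> A \<Longrightarrow> h x \<in> B" "\<And>x. x \<in> A \<Longrightarrow> g (h x) = f x"
  shows "bij_betw h A B"
proof -
  have "inj_on h A" using f h(2) by (metis bij_betw_def inj_on_def)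
  moreover have "y \<in> h ` A" if y: "y \<in> B" for y
  proof -
    have "g y \<in> f ` A" using f g y by (auto simp: bij_betw_def)
    then obtain x where x: "x \<in> A" "g y = f x" by auto
    then have "h x = y" using g h y by (metis bij_betw_def inj_onD)
    then show ?thesis using x by blast
  qed
  ultimately show ?thesis using h(1) by (auto simp: bij_betw_def)
qed

section \<open>The bundle and its S-fibers as sets\<close>

locale multi_fiber_bundle =
  fixes S :: "('s, 'es::real_inner) manifold" and W :: "('w, 'ew::real_inner) manifold"
    and M :: "('m, 'em::real_inner) manifold" and B :: "('b, 'eb::real_inner) manifold"
    and \<pi> :: "'m \<Rightarrow> 'b" and A :: "'i set" and U :: "'i \<Rightarrow> 'b set"
    and \<phi> :: "'i \<Rightarrow> 'm \<Rightarrow> 'b \<times> 's \<times> 'w"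
  assumes S: "smooth_manifold S" and W: "smooth_manifold W"
    and M: "smooth_manifold M" and B: "smooth_manifold B"
    and proj: "smooth_map M B \<pi>" and multi: "multi_fiber_atlas M B \<pi> S W A U \<phi>"
begin

abbreviation "Sp \<equiv> S_fiber M \<pi> S A U \<phi>"
abbreviation "Sm \<equiv> S_fiber_manifold M \<pi> S A U \<phi>"
abbreviation "ad \<alpha> \<equiv> adapted_chart M \<pi> (U \<alpha>) (\<phi> \<alpha>)"
abbreviation "h \<alpha> \<equiv> hcomp (\<phi> \<alpha>)"
abbreviation "f \<alpha> \<equiv> fcomp (\<phi> \<alpha>)"
abbreviation "slice \<alpha> p a s w \<equiv> (fst (ad \<alpha> a s w) \<inter> Sp p, snd s \<circ> h \<alpha>)"

lemma bundle_chart: "\<alpha> \<in> A \<Longrightarrow> bundle_chart M B \<pi> S W (U \<alpha>) (\<phi> \<alpha>)"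
  using multi by (simp add: multi_fiber_atlas_def bundle_atlas_def)

lemmas ad_mem = mem_adapted_chart[OF bundle_chart]
lemmas ad_apply = adapted_chart_apply[OF bundle_chart]
lemmas ad_model = adapted_chart_model_charts[OF M B S W proj bundle_chart]

lemma ex_bundle_chart:
  assumes "p \<in> points M"
  obtains \<alpha> where "\<alpha> \<in> A" "p \<in> over M \<pi> (U \<alpha>)"
proof -
  have "\<pi> p \<in> points B" using proj assms by (auto simp: smooth_map_def)
  then have "\<pi> p \<in> (\<Union>\<alpha>\<in>A. U \<alpha>)"
    using multi by (simp add: multi_fiber_atlas_def bundle_atlas_def)
  then show ?thesis using that assms by (auto simp: over_def)
qed

lemma phi_bij: "\<alpha> \<in> A \<Longrightarrow> bij_betw (\<phi> \<alpha>) (over M \<pi> (U \<alpha>)) (U \<alpha> \<times> points S \<times> points W)"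
  by (rule bundle_chart_bij_betw[OF bundle_chart])

lemma phi_mem:
  assumes "\<alpha> \<in> A" "p \<in> over M \<pi> (U \<alpha>)"
  shows "\<pi> p \<in> U \<alpha>" "h \<alpha> p \<in> points S" "f \<alpha> p \<in> points W"
proof -
  have "\<phi> \<alpha> p \<in> U \<alpha> \<times> points S \<times> points W" using phi_bij[OF assms(1)] assms(2) by (rule bij_betwE[rule_format])
  then show "\<pi> p \<in> U \<alpha>" "h \<alpha> p \<in> points S" "f \<alpha> p \<in> points W"
    using bundle_chart_eq[OF bundle_chart[OF assms(1)] assms(2)] by auto
qed

text \<open>All agreement of S-fibers across bundle charts rests on this use of the multi-fiber
  condition. From here on a fiber is computed in whichever bundle chart is at hand.\<close>

lemma Sp_eq:
  assumes "\<alpha> \<in> A" "p \<in> over M \<pi> (U \<alpha>)"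
  shows "Sp p = S_slice M \<pi> S (U \<alpha>) (\<phi> \<alpha>) p"
proof -
  define \<beta> where "\<beta> = (SOME \<alpha>. \<alpha> \<in> A \<and> \<pi> p \<in> U \<alpha>)"
  have "\<alpha> \<in> A \<and> \<pi> p \<in> U \<alpha>" using assms by (auto simp: over_def)
  then have \<beta>: "\<beta> \<in> A \<and> \<pi> p \<in> U \<beta>" unfolding \<beta>_def by (rule someI)
  then have "p \<in> over M \<pi> (U \<alpha> \<inter> U \<beta>)" using assms by (auto simp: over_def)
  then have "S_slice M \<pi> S (U \<alpha>) (\<phi> \<alpha>) p = S_slice M \<pi> S (U \<beta>) (\<phi> \<beta>) p"
    using multi \<beta> assms(1) unfolding multi_fiber_atlas_def by blast
  then show ?thesis by (simp add: S_fiber_def Let_def \<beta>_def)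
qed

lemma mem_Sp:
  assumes "\<alpha> \<in> A" "p \<in> over M \<pi> (U \<alpha>)"
  shows "q \<in> Sp p \<longleftrightarrow> q \<in> over M \<pi> (U \<alpha>) \<and> \<pi> q = \<pi> p \<and> f \<alpha> q = f \<alpha> p"
  using bundle_chart_eq[OF bundle_chart[OF assms(1)], of q] phi_mem[OF assms(1), of q]
  by (auto simp: Sp_eq[OF assms] S_slice_def)

lemma inj_on_h_Sp:
  assumes "\<alpha> \<in> A" "p \<in> over M \<pi> (U \<alpha>)"
  shows "inj_on (h \<alpha>) (Sp p)"
proof (rule inj_onI)
  fix q r assume qr: "q \<in> Sp p" "r \<in> Sp p" "h \<alpha> q = h \<alpha> r"
  have q: "q \<in> over M \<pi> (U \<alpha>)" "r \<in> over M \<pi> (U \<alpha>)" "\<pi> q = \<pi> r" "f \<alpha> q = f \<alpha> r"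
    using qr(1,2) unfolding mem_Sp[OF assms] by auto
  have "\<phi> \<alpha> q = \<phi> \<alpha> r"
    using bundle_chart_eq[OF bundle_chart[OF assms(1)] q(1)]
      bundle_chart_eq[OF bundle_chart[OF assms(1)] q(2)] q(3,4) qr(3) by simp
  then show "q = r" using phi_bij[OF assms(1)] q(1,2) by (auto simp: bij_betw_def dest: inj_onD)
qed

lemma ex_adapted_chart:
  assumes "\<alpha> \<in> A" "p \<in> over M \<pi> (U \<alpha>)"
  obtains a s w where "a \<in> atlas B" "s \<in> atlas S" "w \<in> atlas W" "p \<in> fst (ad \<alpha> a s w)"
proof -
  have "\<pi> p \<in> points B"
    using proj assms(2) by (auto simp: smooth_map_def over_def)
  then obtain a where a: "a \<in> atlas B" "\<pi> p \<in> fst a" by (rule smooth_manifold_chart_at[OF B])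
  obtain s where s: "s \<in> atlas S" "h \<alpha> p \<in> fst s"
    using phi_mem(2)[OF assms] by (rule smooth_manifold_chart_at[OF S])
  obtain w where w: "w \<in> atlas W" "f \<alpha> p \<in> fst w"
    using phi_mem(3)[OF assms] by (rule smooth_manifold_chart_at[OF W])
  show ?thesis using that[OF a(1) s(1) w(1)] a s w assms by (simp add: ad_mem)
qed

lemma atlas_is_chart:
  "a \<in> atlas B \<Longrightarrow> is_chart (mtop B) a" "s \<in> atlas S \<Longrightarrow> is_chart (mtop S) s"
  "w \<in> atlas W \<Longrightarrow> is_chart (mtop W) w"
  using S W B by (simp_all add: smooth_manifold_def)

lemma Sm_smooth_atlas: "smooth_atlas (Sm p)"
  unfolding S_fiber_manifold_def
  by (rule smooth_atlas_submanifold[OF M smooth_manifold_finite_dim[OF S]])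

section \<open>Slice charts of a fiber and the lifted vector at one point\<close>

context
  fixes \<alpha> p a s w
  assumes \<alpha>: "\<alpha> \<in> A" and a: "a \<in> atlas B" and s: "s \<in> atlas S" and w: "w \<in> atlas W"
    and p: "p \<in> fst (ad \<alpha> a s w)"
begin

lemma p_over: "p \<in> over M \<pi> (U \<alpha>)" and p_mem: "\<pi> p \<in> fst a" "h \<alpha> p \<in> fst s" "f \<alpha> p \<in> fst w"
  using p unfolding ad_mem[OF \<alpha>] by auto

text \<open>\<open>submanifold\<close> asks for a chart in \<open>charts M\<close> that flattens the
  fiber to a linear subspace, whereas \<xi> has the wrong model space and flattens it to an affine
  one. Translation by \<open>x0\<close> moves the slice through the origin and \<open>J\<close>
  carries it into \<open>'em\<close>; the middle component of \<open>K\<close> then serves as the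
  linear identification with \<open>'es\<close> and recovers
  \<open>snd s \<circ> h \<alpha>\<close>.\<close>

lemma slice_in_atlas: "slice \<alpha> p a s w \<in> atlas (Sm p)"
proof -
  let ?\<xi> = "ad \<alpha> a s w"
  have xi: "?\<xi> \<in> model_charts M" by (rule ad_model[OF \<alpha> a s w])
  obtain J :: "'eb \<times> 'es \<times> 'ew \<Rightarrow> 'em" and K where J: "bounded_linear J" and K: "bounded_linear K"
    and KJ: "\<And>x. K (J x) = x" and JK: "\<And>y. J (K y) = y"
    by (rule model_chart_linear_iso[OF M xi p]) blast
  \<comment> \<open>The middle entry is 0, so the translation does not shift the fiber coordinate
    and the resulting slice chart is exactly \<open>snd s \<circ> h \<alpha>\<close>.\<close>
  define x0 where "x0 = (snd a (\<pi> p), 0::'es, snd w (f \<alpha> p))"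
  define T where "T = (\<lambda>x. J (x - x0))"
  define T' where "T' = (\<lambda>y. K y + x0)"
  define i where "i = (\<lambda>y::'es. (0::'eb, y, 0::'ew))"
  have "T = (\<lambda>x. J x + - J x0)"
    by (simp add: T_def linear_diff[OF bounded_linear.linear[OF J]])
  then have T: "smooth_on UNIV T"
    using J by (simp only:) (intro smooth_on_add smooth_on_bounded_linear smooth_on_const open_UNIV)
  have T': "smooth_on UNIV T'" unfolding T'_def
    using K by (intro smooth_on_add smooth_on_bounded_linear smooth_on_const open_UNIV)
  have fd: "finite_dim TYPE('eb \<times> 'es \<times> 'ew)"
    by (intro finite_dim_prod smooth_manifold_finite_dim[OF B] smooth_manifold_finite_dim[OF S]
        smooth_manifold_finite_dim[OF W])
  have C: "(fst ?\<xi>, T \<circ> snd ?\<xi>) \<in> charts M"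
    unfolding charts_eq_model_charts
    by (rule model_chart_compose[OF smooth_manifold_smooth_atlas[OF M] fd xi T T'])
      (simp_all add: T_def T'_def KJ JK)
  define L where "L = range (J \<circ> i)"
  have lin: "linear i" by (auto simp: i_def intro!: linearI)
  have linA: "linear (fst \<circ> (snd \<circ> K))"
    by (intro linear_compose bounded_linear.linear[OF K] bounded_linear.linear[OF bounded_linear_fst]
        bounded_linear.linear[OF bounded_linear_snd])
  have L: "subspace L" unfolding L_def
    by (intro linear_subspace_image linear_compose[OF lin] bounded_linear.linear[OF J] subspace_UNIV)
  have bij: "bij_betw (fst \<circ> (snd \<circ> K)) L UNIV"
    by (rule bij_betwI[where g = "J \<circ> i"]) (auto simp: L_def i_def KJ)
  have iff: "T (snd ?\<xi> q) \<in> L \<longleftrightarrow> q \<in> Sp p" if q: "q \<in> fst ?\<xi>" for q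
  proof -
    have qm: "q \<in> over M \<pi> (U \<alpha>)" "\<pi> q \<in> fst a" "f \<alpha> q \<in> fst w"
      using q unfolding ad_mem[OF \<alpha>] by auto
    have "T (snd ?\<xi> q) \<in> L \<longleftrightarrow> (\<exists>y. J (snd ?\<xi> q - x0) = J (i y))"
      by (auto simp: T_def L_def)
    also have "\<dots> \<longleftrightarrow> (\<exists>y. snd ?\<xi> q - x0 = i y)" using KJ by metis
    also have "\<dots> \<longleftrightarrow> snd a (\<pi> q) = snd a (\<pi> p) \<and> snd w (f \<alpha> q) = snd w (f \<alpha> p)"
      by (auto simp: ad_apply[OF \<alpha> qm(1)] x0_def i_def)
    \<comment> \<open>Injectivity of the charts \<open>a\<close> and \<open>w\<close> turns equal
      coordinates back into equal points, \<open>p\<close> and \<open>q\<close> both having their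
      components in these domains.\<close>
    also have "\<dots> \<longleftrightarrow> \<pi> q = \<pi> p \<and> f \<alpha> q = f \<alpha> p"
      using qm p_mem chart_inj[OF atlas_is_chart(1)[OF a]] chart_inj[OF atlas_is_chart(3)[OF w]]
      by (auto dest: inj_onD)
    finally show ?thesis using qm(1) by (simp add: mem_Sp[OF \<alpha> p_over])
  qed
  have im: "(T \<circ> snd ?\<xi>) ` (fst ?\<xi> \<inter> Sp p) = (T \<circ> snd ?\<xi>) ` fst ?\<xi> \<inter> L"
    using iff by auto
  have eq: "(fst \<circ> (snd \<circ> K)) \<circ> (T \<circ> snd ?\<xi>) = snd s \<circ> h \<alpha>"
    by (rule ext) (simp add: T_def KJ x0_def adapted_chart_def hcomp_def)
  have "\<exists>V \<psi> A'. slice \<alpha> p a s w = (V \<inter> Sp p, A' \<circ> \<psi>) \<and> (V, \<psi>) \<in> charts M \<and> linear A' \<and>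
      (\<exists>L. subspace L \<and> bij_betw A' L UNIV \<and> \<psi> ` (V \<inter> Sp p) = \<psi> ` V \<inter> L)"
    by (rule exI[of _ "fst ?\<xi>"], rule exI[of _ "T \<circ> snd ?\<xi>"], rule exI[of _ "fst \<circ> (snd \<circ> K)"],
        intro conjI exI[of _ L] L bij im C linA) (simp only: eq)
  then show ?thesis
    unfolding S_fiber_manifold_def submanifold_def manifold.simps mem_Collect_eq .
qed

lemma slice_charts_at: "slice \<alpha> p a s w \<in> charts_at (Sm p) p"
  using slice_in_atlas atlas_subset_charts[OF Sm_smooth_atlas[of p]] p mem_Sp[OF \<alpha> p_over, of p] p_over
  by (auto simp: charts_at_def)

lemma Sm_regular: "tangent_regular (Sm p) p"
  using smooth_atlas_tangent_regular[OF Sm_smooth_atlas slice_in_atlas] charts_atD[OF slice_charts_at]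
  by blast

lemma slice_is_chart: "is_chart (mtop (Sm p)) (slice \<alpha> p a s w)"
  using charts_atD[OF slice_charts_at] by blast

text \<open>The bundle chart maps onto all of
  \<open>U \<alpha> \<times> points S \<times> points W\<close>, so each coordinate in
  \<open>cimage s\<close> is attained on the fiber through \<open>p\<close>. The slice chart thus
  has the same image as \<open>s\<close>, with no shrinking.\<close>

lemma cinv_slice:
  assumes y: "y \<in> cimage s"
  shows "cinv (slice \<alpha> p a s w) y = cinv (ad \<alpha> a s w) (snd a (\<pi> p), y, snd w (f \<alpha> p))"
    and "(snd a (\<pi> p), y, snd w (f \<alpha> p)) \<in> cimage (ad \<alpha> a s w)"
    and "cinv (slice \<alpha> p a s w) y \<in> fst (slice \<alpha> p a s w)"
    and "h \<alpha> (cinv (slice \<alpha> p a s w) y) = cinv s y"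
proof -
  let ?\<xi> = "ad \<alpha> a s w" and ?c = "slice \<alpha> p a s w" and ?y = "(snd a (\<pi> p), y, snd w (f \<alpha> p))"
  have xc: "is_chart (mtop M) ?\<xi>" by (rule is_chart_model_charts[OF ad_model[OF \<alpha> a s w]])
  have sy: "cinv s y \<in> fst s" "snd s (cinv s y) = y" using cinv_in[OF y] chart_cinv[OF y] by auto
  then have "cinv s y \<in> points S" using is_chart_points[OF atlas_is_chart(2)[OF s]] by auto
  then have "(\<pi> p, cinv s y, f \<alpha> p) \<in> \<phi> \<alpha> ` over M \<pi> (U \<alpha>)"
    using phi_bij[OF \<alpha>] phi_mem[OF \<alpha> p_over] by (simp add: bij_betw_def)
  then obtain q where q: "q \<in> over M \<pi> (U \<alpha>)" "\<phi> \<alpha> q = (\<pi> p, cinv s y, f \<alpha> p)" by auto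
  have qc: "\<pi> q = \<pi> p" "h \<alpha> q = cinv s y" "f \<alpha> q = f \<alpha> p"
    using bundle_chart_eq[OF bundle_chart[OF \<alpha>] q(1)] q(2) by auto
  have qx: "q \<in> fst ?\<xi>" using q(1) qc sy p_mem by (simp add: ad_mem[OF \<alpha>])
  have xq: "snd ?\<xi> q = ?y" using qc sy by (simp add: ad_apply[OF \<alpha> q(1)])
  have qS: "q \<in> fst ?c" using qx q(1) qc by (simp add: mem_Sp[OF \<alpha> p_over])
  have "cinv ?\<xi> ?y = q" using cinv_chart[OF xc qx] xq by simp
  moreover have cq: "cinv ?c y = q" using cinv_chart[OF slice_is_chart qS] qc sy by simp
  ultimately show "cinv ?c y = cinv ?\<xi> ?y" by simp
  show "?y \<in> cimage ?\<xi>" using qx xq by (force simp: cimage_def)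
  show "cinv ?c y \<in> fst ?c" using cq qS by simp
  show "h \<alpha> (cinv ?c y) = cinv s y" using cq qc by simp
qed

lemma s_charts_at: "s \<in> charts_at S (h \<alpha> p)"
  using s p_mem atlas_subset_charts[OF smooth_manifold_smooth_atlas[OF S]] by (auto simp: charts_at_def)

lemma s_regular: "tangent_regular S (h \<alpha> p)"
  by (rule smooth_manifold_tangent_regular[OF S phi_mem(2)[OF \<alpha> p_over]])

lemma open_cimage_s: "open (cimage s)" and h_cimage_s: "snd s (h \<alpha> p) \<in> cimage s"
  using chart_open_cimage[OF atlas_is_chart(2)[OF s]] p_mem by (auto simp: cimage_def)

lemma eventually_cimage_s: "\<forall>\<^sub>F y in nhds (snd s (h \<alpha> p)). y \<in> cimage s"
  by (rule eventually_nhds_in_open[OF open_cimage_s h_cimage_s])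

lemma T_h_component:
  assumes v: "v \<in> tangent_space (Sm p) p"
  shows "T_h M \<pi> S A U \<phi> \<alpha> p v \<in> tangent_space S (h \<alpha> p)"
    and "T_h M \<pi> S A U \<phi> \<alpha> p v s = v (slice \<alpha> p a s w)"
proof -
  let ?c = "slice \<alpha> p a s w"
  have "(snd s \<circ> h \<alpha> \<circ> cinv ?c has_derivative (\<lambda>v. v)) (at (snd ?c p))"
  proof (rule has_derivative_transform_within_open[OF has_derivative_ident open_cimage_s])
    show "y = (snd s \<circ> h \<alpha> \<circ> cinv ?c) y" if "y \<in> cimage s" for y
      using cinv_slice(4)[OF that] chart_cinv[OF that] by simp
  qed (simp add: h_cimage_s)
  moreover have "\<forall>\<^sub>F y in nhds (snd ?c p). h \<alpha> (cinv ?c y) \<in> fst s"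
  proof -
    have "\<forall>\<^sub>F y in nhds (snd s (h \<alpha> p)). h \<alpha> (cinv ?c y) \<in> fst s"
      using eventually_cimage_s by eventually_elim (metis cinv_slice(4) cinv_in)
    then show ?thesis by simp
  qed
  ultimately show "T_h M \<pi> S A U \<phi> \<alpha> p v \<in> tangent_space S (h \<alpha> p)"
    and "T_h M \<pi> S A U \<phi> \<alpha> p v s = v ?c"
    unfolding T_h_def
    using tangent_map_component[where f = "h \<alpha>" and c = ?c and d = s and Df = "\<lambda>v. v",
        OF Sm_regular s_regular slice_charts_at s_charts_at _ _ v] by blast+
qed

lemma T_h_bij:
  "bij_betw (T_h M \<pi> S A U \<phi> \<alpha> p) (tangent_space (Sm p) p) (tangent_space S (h \<alpha> p))"
  by (rule bij_betw_factor[OF bij_betw_tangent_component[OF Sm_regular slice_charts_at]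
        bij_betw_tangent_component[OF s_regular s_charts_at]])
    (simp_all add: T_h_component)

text \<open>A tangent vector of \<open>M\<close> has no \<xi>-component, since \<xi> is not of the
  type of the charts of \<open>M\<close>. The assertion that its \<xi>-coordinates are
  \<open>(0, v, 0)\<close> is therefore phrased by transporting this triple to a genuine chart
  \<open>d\<close>.\<close>

lemma inclusion_component:
  assumes v: "v \<in> tangent_space (Sm p) p" and d: "d \<in> charts_at M p"
  shows "tangent_map (Sm p) M (\<lambda>q. q) p v \<in> tangent_space M p"
    and "tangent_map (Sm p) M (\<lambda>q. q) p v d =
      transition_deriv (ad \<alpha> a s w) d p (0, v (slice \<alpha> p a s w), 0)"
proof -
  let ?\<xi> = "ad \<alpha> a s w" and ?c = "slice \<alpha> p a s w"
  \<comment> \<open>The inclusion of the fiber, read from the slice chart to \<xi>: base and W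
    coordinates stay frozen at those of \<open>p\<close>.\<close>
  define i where "i = (\<lambda>y::'es. (snd a (\<pi> p), y, snd w (f \<alpha> p)))"
  have xi: "?\<xi> \<in> model_charts M" by (rule ad_model[OF \<alpha> a s w])
  have xc: "is_chart (mtop M) ?\<xi>" by (rule is_chart_model_charts[OF xi])
  have dM: "d \<in> model_charts M" and dc: "is_chart (mtop M) d" and pd: "p \<in> fst d"
    using d charts_atD[OF d] by (simp_all add: charts_at_def charts_eq_model_charts)
  have ip: "i (snd s (h \<alpha> p)) = snd ?\<xi> p" by (simp add: i_def ad_apply[OF \<alpha> p_over])
  have i': "(i has_derivative (\<lambda>v. (0, v, 0))) (at y)" for y
    unfolding i_def by (intro has_derivative_Pair has_derivative_const has_derivative_ident)
  have tr: "(snd d \<circ> cinv ?\<xi> has_derivative transition_deriv ?\<xi> d p) (at (snd ?\<xi> p))"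
    by (rule smooth_transition_has_derivative[OF model_charts_smooth_transition[OF M xi dM] p pd])
  have "((\<lambda>y. (snd d \<circ> cinv ?\<xi>) (i y)) has_derivative (\<lambda>v. transition_deriv ?\<xi> d p (0, v, 0)))
      (at (snd s (h \<alpha> p)))"
    by (rule has_derivative_compose[OF i']) (simp only: ip tr)
  then have "(snd d \<circ> (\<lambda>q. q) \<circ> cinv ?c has_derivative (\<lambda>v. transition_deriv ?\<xi> d p (0, v, 0)))
      (at (snd s (h \<alpha> p)))"
    by (rule has_derivative_transform_within_open[OF _ open_cimage_s h_cimage_s])
      (simp add: cinv_slice(1) i_def)
  then have der: "(snd d \<circ> (\<lambda>q. q) \<circ> cinv ?c has_derivative (\<lambda>v. transition_deriv ?\<xi> d p (0, v, 0)))
      (at (snd ?c p))" by simp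
  have ev: "\<forall>\<^sub>F y in nhds (snd ?c p). cinv ?c y \<in> fst d"
  proof -
    define G where "G = snd ?\<xi> ` (fst ?\<xi> \<inter> fst d)"
    have "open G" unfolding G_def by (rule chart_open_image[OF xc chart_openin[OF dc]])
    moreover have "continuous_on UNIV i"
      unfolding i_def by (intro continuous_intros)
    ultimately have "open (i -` G)" by (rule open_vimage)
    moreover have "snd s (h \<alpha> p) \<in> i -` G" using p pd ip by (auto simp: G_def)
    ultimately have "\<forall>\<^sub>F y in nhds (snd s (h \<alpha> p)). y \<in> i -` G" by (rule eventually_nhds_in_open)
    with eventually_cimage_s have "\<forall>\<^sub>F y in nhds (snd s (h \<alpha> p)). cinv ?c y \<in> fst d"
    proof eventually_elim
      case (elim y)
      then obtain q where q: "q \<in> fst ?\<xi>" "q \<in> fst d" "i y = snd ?\<xi> q" by (auto simp: G_def)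
      then have "cinv ?c y = q" using cinv_slice(1)[OF elim(1)] cinv_chart[OF xc q(1)] by (simp add: i_def)
      then show ?case using q by simp
    qed
    then show ?thesis by simp
  qed
  have "p \<in> points M" using p_over by (simp add: over_def)
  then have "tangent_regular M p" by (rule smooth_manifold_tangent_regular[OF M])
  from tangent_map_component[where N = M and f = "\<lambda>q. q", OF Sm_regular this slice_charts_at d der ev v]
  show "tangent_map (Sm p) M (\<lambda>q. q) p v \<in> tangent_space M p"
    and "tangent_map (Sm p) M (\<lambda>q. q) p v d = transition_deriv ?\<xi> d p (0, v ?c, 0)" .
qed

context
  fixes X assumes X: "vector_field S X"
begin

lemma X_tangent: "X (h \<alpha> p) \<in> tangent_space S (h \<alpha> p)"
  using X phi_mem(2)[OF \<alpha> p_over] by (simp add: vector_field_def)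

lemma vertical_vector:
  defines "v \<equiv> inv_into (tangent_space (Sm p) p) (T_h M \<pi> S A U \<phi> \<alpha> p) (X (h \<alpha> p))"
  shows "v \<in> tangent_space (Sm p) p" "T_h M \<pi> S A U \<phi> \<alpha> p v = X (h \<alpha> p)"
    "v (slice \<alpha> p a s w) = X (h \<alpha> p) s"
proof -
  have im: "X (h \<alpha> p) \<in> T_h M \<pi> S A U \<phi> \<alpha> p ` tangent_space (Sm p) p"
    using T_h_bij X_tangent by (simp add: bij_betw_def)
  show v: "v \<in> tangent_space (Sm p) p" unfolding v_def by (rule inv_into_into[OF im])
  show T: "T_h M \<pi> S A U \<phi> \<alpha> p v = X (h \<alpha> p)" unfolding v_def by (rule f_inv_into_f[OF im])
  show "v (slice \<alpha> p a s w) = X (h \<alpha> p) s" using T_h_component(2)[OF v] T by simp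
qed

lemma fiber_lift_component:
  assumes d: "d \<in> charts_at M p"
  shows "fiber_lift M \<pi> S A U \<phi> X \<alpha> p \<in> tangent_space M p"
    and "fiber_lift M \<pi> S A U \<phi> X \<alpha> p d = transition_deriv (ad \<alpha> a s w) d p (0, X (h \<alpha> p) s, 0)"
  using inclusion_component[OF vertical_vector(1) d]
  unfolding fiber_lift_def vertical_vector(3) by blast+

end

end

section \<open>Independence of the bundle chart and smoothness of the lifted field\<close>

lemma h_transition_apply:
  assumes \<alpha>: "\<alpha> \<in> A" "p \<in> over M \<pi> (U \<alpha>)" and \<beta>: "\<beta> \<in> A" "p \<in> over M \<pi> (U \<beta>)" and q: "q \<in> Sp p"
  shows "h_transition M \<pi> S A U \<phi> \<alpha> \<beta> p (h \<beta> q) = h \<alpha> q"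
proof -
  have "q \<in> over M \<pi> (U \<beta>)" using q by (simp add: mem_Sp[OF \<beta>])
  then have "h \<beta> q \<in> points S" by (rule phi_mem(2)[OF \<beta>(1)])
  then show ?thesis using q inj_on_h_Sp[OF \<beta>] by (simp add: h_transition_def compose_def)
qed

lemma h_transition_tangent_map:
  assumes \<alpha>: "\<alpha> \<in> A" "a' \<in> atlas B" "s' \<in> atlas S" "w' \<in> atlas W" "p \<in> fst (ad \<alpha> a' s' w')"
    and \<beta>: "\<beta> \<in> A" "a \<in> atlas B" "s \<in> atlas S" "w \<in> atlas W" "p \<in> fst (ad \<beta> a s w)"
    and v: "v \<in> tangent_space S (h \<beta> p)"
  shows "tangent_map S S (h_transition M \<pi> S A U \<phi> \<alpha> \<beta> p) (h \<beta> p) v s' =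
    transition_deriv (slice \<beta> p a s w) (slice \<alpha> p a' s' w') p (v s)"
proof -
  let ?h = "h_transition M \<pi> S A U \<phi> \<alpha> \<beta> p"
  let ?c = "slice \<beta> p a s w" and ?c' = "slice \<alpha> p a' s' w'"
  note p\<alpha> = p_over[OF \<alpha>] and p\<beta> = p_over[OF \<beta>]
  have c: "?c \<in> charts_at (Sm p) p" and c': "?c' \<in> charts_at (Sm p) p"
    by (rule slice_charts_at[OF \<beta>], rule slice_charts_at[OF \<alpha>])
  have pS: "p \<in> Sp p" using c by (simp add: charts_at_def)
  have hp: "?h (h \<beta> p) = h \<alpha> p" by (rule h_transition_apply[OF \<alpha>(1) p\<alpha> \<beta>(1) p\<beta> pS])
  \<comment> \<open>The fiber point with \<beta>-component \<open>cinv s y\<close> is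
    \<open>cinv ?c y\<close>, and the transition sends the \<beta>-component of a fiber point to its
    \<alpha>-component. This matches the coordinate form of \<open>?h\<close> with the transition of
    slice charts.\<close>
  have hc: "?h (cinv s y) = h \<alpha> (cinv ?c y)" if y: "y \<in> cimage s" for y
    using h_transition_apply[OF \<alpha>(1) p\<alpha> \<beta>(1) p\<beta>, of "cinv ?c y"] cinv_slice(3,4)[OF \<beta> y] by simp
  \<comment> \<open>Differentiability of \<open>?h\<close> at the point is inherited from the
    compatibility of slice charts of the fiber.\<close>
  have "(snd ?c' \<circ> cinv ?c has_derivative transition_deriv ?c ?c' p) (at (snd ?c p))"
    using Sm_regular[OF \<beta>] c c' unfolding tangent_regular_def by blast
  then have "(snd ?c' \<circ> cinv ?c has_derivative transition_deriv ?c ?c' p) (at (snd s (h \<beta> p)))"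
    by simp
  then have der: "(snd s' \<circ> ?h \<circ> cinv s has_derivative transition_deriv ?c ?c' p) (at (snd s (h \<beta> p)))"
    by (rule has_derivative_transform_within_open[OF _ open_cimage_s[OF \<beta>] h_cimage_s[OF \<beta>]])
      (simp add: hc)
  have op: "open (snd ?c ` (fst ?c \<inter> fst ?c'))"
    by (rule chart_open_image[OF slice_is_chart[OF \<beta>] chart_openin[OF slice_is_chart[OF \<alpha>]]])
  have "snd s (h \<beta> p) \<in> snd ?c ` (fst ?c \<inter> fst ?c')"
    using pS \<alpha>(5) \<beta>(5) by auto
  then have "\<forall>\<^sub>F y in nhds (snd s (h \<beta> p)). y \<in> snd ?c ` (fst ?c \<inter> fst ?c')"
    by (rule eventually_nhds_in_open[OF op])
  with eventually_cimage_s[OF \<beta>] have ev: "\<forall>\<^sub>F y in nhds (snd s (h \<beta> p)). ?h (cinv s y) \<in> fst s'"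
  proof eventually_elim
    case (elim y)
    then obtain q where q: "q \<in> fst ?c" "q \<in> fst ?c'" "y = snd ?c q" by blast
    have "cinv ?c y = q" using cinv_chart[OF slice_is_chart[OF \<beta>] q(1)] q(3) by simp
    moreover have "h \<alpha> q \<in> fst s'" using q(2) by (simp add: ad_mem[OF \<alpha>(1)])
    ultimately show ?case using hc[OF elim(1)] by simp
  qed
  have "tangent_regular S (?h (h \<beta> p))" "s' \<in> charts_at S (?h (h \<beta> p))"
    using s_regular[OF \<alpha>] s_charts_at[OF \<alpha>] hp by simp_all
  then show ?thesis
    by (rule tangent_map_component(2)[OF s_regular[OF \<beta>] _ s_charts_at[OF \<beta>] _ der ev v])
qed

text \<open>It is enough that the fiber vector \<open>v\<close> obtained from \<beta> is also mapped
  by the \<alpha>-tangent map to \<open>X (h \<alpha> p)\<close>: that map is injective, and the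
  inclusion applied afterwards is the same for both charts.\<close>

lemma fiber_lift_independent:
  assumes X: "vector_field S X" and inv: "invariant_field S (structure_group M \<pi> S A U \<phi>) X"
    and \<alpha>: "\<alpha> \<in> A" "p \<in> over M \<pi> (U \<alpha>)" and \<beta>: "\<beta> \<in> A" "p \<in> over M \<pi> (U \<beta>)"
  shows "fiber_lift M \<pi> S A U \<phi> X \<alpha> p = fiber_lift M \<pi> S A U \<phi> X \<beta> p"
proof -
  let ?h = "h_transition M \<pi> S A U \<phi> \<alpha> \<beta> p"
  obtain a' s' w' where \<alpha>': "a' \<in> atlas B" "s' \<in> atlas S" "w' \<in> atlas W" "p \<in> fst (ad \<alpha> a' s' w')"
    by (rule ex_adapted_chart[OF \<alpha>])
  obtain a s w where \<beta>': "a \<in> atlas B" "s \<in> atlas S" "w \<in> atlas W" "p \<in> fst (ad \<beta> a s w)"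
    by (rule ex_adapted_chart[OF \<beta>])
  note A' = \<alpha>(1) \<alpha>' and B' = \<beta>(1) \<beta>'
  let ?c = "slice \<beta> p a s w" and ?c' = "slice \<alpha> p a' s' w'"
  define v where "v = inv_into (tangent_space (Sm p) p) (T_h M \<pi> S A U \<phi> \<beta> p) (X (h \<beta> p))"
  have v: "v \<in> tangent_space (Sm p) p" "v ?c = X (h \<beta> p) s"
    unfolding v_def by (rule vertical_vector[OF B' X])+
  have pS: "p \<in> Sp p" using slice_charts_at[OF B'] by (simp add: charts_at_def)
  \<comment> \<open>Invariance is applied to one of the generators of the structure group, at the
    point \<open>h \<beta> p\<close>.\<close>
  have "?h \<in> structure_group M \<pi> S A U \<phi>"
    unfolding structure_group_def using \<alpha> \<beta>
    by (intro generate.incl CollectI exI[of _ \<alpha>] exI[of _ \<beta>] exI[of _ p]) (simp add: over_def)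
  then have "tangent_map S S ?h (h \<beta> p) (X (h \<beta> p)) = X (?h (h \<beta> p))"
    using inv phi_mem(2)[OF \<beta>] unfolding invariant_field_def by blast
  also have "?h (h \<beta> p) = h \<alpha> p" by (rule h_transition_apply[OF \<alpha> \<beta> pS])
  finally have "X (h \<alpha> p) s' = transition_deriv ?c ?c' p (X (h \<beta> p) s)"
    using h_transition_tangent_map[OF A' B' X_tangent[OF B' X]] by simp
  also have "\<dots> = v ?c'"
    using tangent_space_component[OF v(1) slice_charts_at[OF B'] slice_charts_at[OF A']] v(2) by simp
  also have "\<dots> = T_h M \<pi> S A U \<phi> \<alpha> p v s'"
    by (rule T_h_component(2)[OF A' v(1), symmetric])
  finally have eq: "X (h \<alpha> p) s' = T_h M \<pi> S A U \<phi> \<alpha> p v s'" .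
  \<comment> \<open>The equation was obtained in the single chart \<open>s'\<close>; one component
    decides equality of tangent vectors.\<close>
  have "inj_on (\<lambda>v. v s') (tangent_space S (h \<alpha> p))"
    using bij_betw_tangent_component[OF s_regular[OF A'] s_charts_at[OF A']] by (simp add: bij_betw_def)
  then have "X (h \<alpha> p) = T_h M \<pi> S A U \<phi> \<alpha> p v"
    using eq X_tangent[OF A' X] T_h_component(1)[OF A' v(1)] by (rule inj_onD)
  then have "inv_into (tangent_space (Sm p) p) (T_h M \<pi> S A U \<phi> \<alpha> p) (X (h \<alpha> p)) = v"
    using T_h_bij[OF A'] v(1) by (simp add: bij_betw_def)
  then show ?thesis by (simp add: fiber_lift_def v_def)
qed

text \<open>Near each point the \<open>c\<close>-component is the derivative of
  \<open>snd c \<circ> cinv ?\<xi>\<close> applied to \<open>(0, X (h \<alpha> p) s, 0)\<close>.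
  Both the base point of this derivative and the vector vary smoothly with the
  \<open>c\<close>-coordinates.\<close>

lemma smooth_lift:
  assumes X: "vector_field S X" and c: "c \<in> charts M"
    and lift: "\<And>\<alpha> p. \<alpha> \<in> A \<Longrightarrow> p \<in> over M \<pi> (U \<alpha>) \<Longrightarrow> X' p = fiber_lift M \<pi> S A U \<phi> X \<alpha> p"
  shows "smooth_on (cimage c) (\<lambda>x. X' (cinv c x) c)"
proof (rule smooth_on_local)
  fix x assume x: "x \<in> cimage c"
  have cM: "c \<in> model_charts M" and cc: "is_chart (mtop M) c"
    using c by (simp_all add: charts_eq_model_charts is_chart_model_charts)
  have xp: "cinv c x \<in> fst c" "snd c (cinv c x) = x" using cinv_in[OF x] chart_cinv[OF x] by simp_all
  then have "cinv c x \<in> points M" using is_chart_points[OF cc] by blast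
  then obtain \<alpha> where \<alpha>: "\<alpha> \<in> A" "cinv c x \<in> over M \<pi> (U \<alpha>)" by (rule ex_bundle_chart)
  obtain a s w where asw: "a \<in> atlas B" "s \<in> atlas S" "w \<in> atlas W" "cinv c x \<in> fst (ad \<alpha> a s w)"
    by (rule ex_adapted_chart[OF \<alpha>])
  let ?\<xi> = "ad \<alpha> a s w"
  have xi: "?\<xi> \<in> model_charts M" by (rule ad_model[OF \<alpha>(1) asw(1-3)])
  have xc: "is_chart (mtop M) ?\<xi>" by (rule is_chart_model_charts[OF xi])
  define V where "V = snd c ` (fst c \<inter> fst ?\<xi>)"
  have V: "open V" unfolding V_def by (rule chart_open_image[OF cc chart_openin[OF xc]])
  have u: "smooth_on V (snd ?\<xi> \<circ> cinv c)"
    using model_charts_smooth_transition[OF M cM xi] by (simp add: smooth_transition_def V_def)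
  have g: "smooth_on (snd ?\<xi> ` (fst ?\<xi> \<inter> fst c)) (snd c \<circ> cinv ?\<xi>)"
    using model_charts_smooth_transition[OF M xi cM] by (simp add: smooth_transition_def)
  have fd: "finite_dim TYPE('es)" "finite_dim TYPE('eb \<times> 'es \<times> 'ew)"
    by (intro finite_dim_prod smooth_manifold_finite_dim[OF B] smooth_manifold_finite_dim[OF S]
        smooth_manifold_finite_dim[OF W])+
  have sc: "s \<in> charts S"
    using atlas_subset_charts[OF smooth_manifold_smooth_atlas[OF S]] asw(2) by blast
  then have F: "smooth_on (cimage s) (\<lambda>z. X (cinv s z) s)" using X by (simp add: vector_field_def)
  have V_cases: "\<exists>q. q \<in> fst c \<and> q \<in> fst ?\<xi> \<and> q \<in> over M \<pi> (U \<alpha>) \<and> h \<alpha> q \<in> fst s \<and> cinv c y = q"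
    if y: "y \<in> V" for y
  proof -
    obtain q where q: "q \<in> fst c" "q \<in> fst ?\<xi>" "y = snd c q" using y unfolding V_def by blast
    then show ?thesis using ad_mem[OF \<alpha>(1), of q a s w] cinv_chart[OF cc q(1)] by blast
  qed
  \<comment> \<open>Smoothness of \<open>h \<alpha>\<close> in coordinates is obtained as that of
    the middle component of \<xi>.\<close>
  have s1: "smooth_on V ((fst \<circ> snd) \<circ> (snd ?\<xi> \<circ> cinv c))"
    by (rule smooth_on_compose[OF fd(2) V _ u smooth_on_bounded_linear[OF open_UNIV]])
      (auto intro: bounded_linear_compose[OF bounded_linear_fst bounded_linear_snd, folded o_def])
  have s2: "smooth_on V (snd s \<circ> h \<alpha> \<circ> cinv c)"
  proof (rule smooth_on_cong[OF s1 V])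
    fix y assume "y \<in> V"
    from V_cases[OF this] obtain q where "q \<in> over M \<pi> (U \<alpha>)" "cinv c y = q" by blast
    then show "((fst \<circ> snd) \<circ> (snd ?\<xi> \<circ> cinv c)) y = (snd s \<circ> h \<alpha> \<circ> cinv c) y"
      by (simp add: ad_apply[OF \<alpha>(1)])
  qed
  have s3: "smooth_on V ((\<lambda>z. X (cinv s z) s) \<circ> (snd s \<circ> h \<alpha> \<circ> cinv c))"
  proof (rule smooth_on_compose[OF fd(1) V _ s2 F])
    show "(snd s \<circ> h \<alpha> \<circ> cinv c) ` V \<subseteq> cimage s"
    proof (rule image_subsetI)
      fix y assume "y \<in> V"
      from V_cases[OF this] show "(snd s \<circ> h \<alpha> \<circ> cinv c) y \<in> cimage s" by (auto simp: cimage_def)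
    qed
  qed
  have s4: "smooth_on V (\<lambda>y. (0::'eb, X (h \<alpha> (cinv c y)) s, 0::'ew))"
  proof (intro smooth_on_Pair V smooth_on_const)
    show "smooth_on V (\<lambda>y. X (h \<alpha> (cinv c y)) s)"
    proof (rule smooth_on_cong[OF s3 V])
      fix y assume "y \<in> V"
      from V_cases[OF this]
      show "((\<lambda>z. X (cinv s z) s) \<circ> (snd s \<circ> h \<alpha> \<circ> cinv c)) y = X (h \<alpha> (cinv c y)) s"
        by (auto simp: cinv_chart[OF atlas_is_chart(2)[OF asw(2)]])
    qed
  qed
  have "smooth_on V (\<lambda>y. frechet_derivative (snd c \<circ> cinv ?\<xi>) (at ((snd ?\<xi> \<circ> cinv c) y))
      (0, X (h \<alpha> (cinv c y)) s, 0))"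
    by (rule smooth_on_frechet_derivative[OF fd(2) V _ g u s4])
      (auto simp: V_def cinv_chart[OF cc])
  then have "smooth_on V (\<lambda>y. X' (cinv c y) c)"
  proof (rule smooth_on_cong[OF _ V])
    fix y assume "y \<in> V"
    from V_cases[OF this] obtain q where q: "q \<in> fst c" "q \<in> fst ?\<xi>" "q \<in> over M \<pi> (U \<alpha>)" "cinv c y = q"
      by blast
    have "c \<in> charts_at M q" using c q by (simp add: charts_at_def)
    then show "frechet_derivative (snd c \<circ> cinv ?\<xi>) (at ((snd ?\<xi> \<circ> cinv c) y))
        (0, X (h \<alpha> (cinv c y)) s, 0) = X' (cinv c y) c"
      using fiber_lift_component(2)[OF \<alpha>(1) asw(1-3) q(2) X] q(4) lift[OF \<alpha>(1) q(3)]
      by (simp add: transition_deriv_def)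
  qed
  moreover have "x \<in> V" using xp asw(4) by (force simp: V_def)
  ultimately show "\<exists>V. open V \<and> x \<in> V \<and> smooth_on V (\<lambda>x. X' (cinv c x) c)" using V by blast
qed

end

text \<open>The first conjunct ensures that \<open>inv_into\<close> in \<open>fiber_lift\<close> is
  a true inverse, so that the other two speak of the intended vector.\<close>

theorem mainTheorem3:
  fixes S :: "('s, 'es::real_inner) manifold"
    and W :: "('w, 'ew::real_inner) manifold"
    and M :: "('m, 'em::real_inner) manifold"
    and B :: "('b, 'eb::real_inner) manifold"
    and \<pi> :: "'m \<Rightarrow> 'b"
    and A :: "'i set"
    and U :: "'i \<Rightarrow> 'b set"
    and \<phi> :: "'i \<Rightarrow> 'm \<Rightarrow> 'b \<times> 's \<times> 'w"
    and X :: "'s \<Rightarrow> ('s, 'es) tvec"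
  assumes "smooth_manifold S" and "compact_space (mtop S)"
    and "smooth_manifold W" and "compact_space (mtop W)"
    and "smooth_manifold M" and "smooth_manifold B"
    and "smooth_map M B \<pi>"
    and "multi_fiber_atlas M B \<pi> S W A U \<phi>"
    and "vector_field S X"
    and "invariant_field S (structure_group M \<pi> S A U \<phi>) X"
  shows "(\<forall>\<alpha>\<in>A. \<forall>p\<in>over M \<pi> (U \<alpha>).
            bij_betw (T_h M \<pi> S A U \<phi> \<alpha> p)
              (tangent_space (S_fiber_manifold M \<pi> S A U \<phi> p) p)
              (tangent_space S (hcomp (\<phi> \<alpha>) p))) \<and>
         (\<forall>\<alpha>\<in>A. \<forall>\<beta>\<in>A. \<forall>p\<in>over M \<pi> (U \<alpha> \<inter> U \<beta>).
            fiber_lift M \<pi> S A U \<phi> X \<alpha> p = fiber_lift M \<pi> S A U \<phi> X \<beta> p) \<and>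
         (\<exists>X'. vector_field M X' \<and>
            (\<forall>\<alpha>\<in>A. \<forall>p\<in>over M \<pi> (U \<alpha>). X' p = fiber_lift M \<pi> S A U \<phi> X \<alpha> p))"
proof -
  interpret multi_fiber_bundle S W M B \<pi> A U \<phi>
    by unfold_locales (fact assms)+
  note X = assms(9) and indep = fiber_lift_independent[OF assms(9,10)]
  have bij: "bij_betw (T_h M \<pi> S A U \<phi> \<alpha> p) (tangent_space (Sm p) p) (tangent_space S (h \<alpha> p))"
    if \<alpha>: "\<alpha> \<in> A" "p \<in> over M \<pi> (U \<alpha>)" for \<alpha> p
  proof -
    obtain a s w where "a \<in> atlas B" "s \<in> atlas S" "w \<in> atlas W" "p \<in> fst (ad \<alpha> a s w)"
      by (rule ex_adapted_chart[OF \<alpha>])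
    from T_h_bij[OF \<alpha>(1) this] show ?thesis .
  qed
  \<comment> \<open>Outside \<open>points M\<close> no index qualifies and the value is arbitrary;
    \<open>vector_field\<close> examines only points of \<open>M\<close>.\<close>
  define X' where "X' p = fiber_lift M \<pi> S A U \<phi> X (SOME \<alpha>. \<alpha> \<in> A \<and> p \<in> over M \<pi> (U \<alpha>)) p" for p
  have lift: "X' p = fiber_lift M \<pi> S A U \<phi> X \<alpha> p" if \<alpha>: "\<alpha> \<in> A" "p \<in> over M \<pi> (U \<alpha>)" for \<alpha> p
  proof -
    have "(SOME \<alpha>. \<alpha> \<in> A \<and> p \<in> over M \<pi> (U \<alpha>)) \<in> A \<and>
        p \<in> over M \<pi> (U (SOME \<alpha>. \<alpha> \<in> A \<and> p \<in> over M \<pi> (U \<alpha>)))"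
      by (rule someI[of "\<lambda>\<alpha>. \<alpha> \<in> A \<and> p \<in> over M \<pi> (U \<alpha>)" \<alpha>]) (use \<alpha> in simp)
    then show ?thesis unfolding X'_def using indep \<alpha> by blast
  qed
  have "X' p \<in> tangent_space M p" if p: "p \<in> points M" for p
  proof -
    obtain \<alpha> where \<alpha>: "\<alpha> \<in> A" "p \<in> over M \<pi> (U \<alpha>)" by (rule ex_bundle_chart[OF p])
    obtain a s w where asw: "a \<in> atlas B" "s \<in> atlas S" "w \<in> atlas W" "p \<in> fst (ad \<alpha> a s w)"
      by (rule ex_adapted_chart[OF \<alpha>])
    obtain d where "d \<in> charts_at M p"
      using smooth_manifold_tangent_regular[OF assms(5) p] by (auto simp: tangent_regular_def)
    from fiber_lift_component(1)[OF \<alpha>(1) asw X this] show ?thesis using lift[OF \<alpha>] by simp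
  qed
  then have "vector_field M X'"
    using smooth_lift[OF X _ lift] by (simp add: vector_field_def)
  moreover have "\<forall>\<alpha>\<in>A. \<forall>\<beta>\<in>A. \<forall>p\<in>over M \<pi> (U \<alpha> \<inter> U \<beta>).
      fiber_lift M \<pi> S A U \<phi> X \<alpha> p = fiber_lift M \<pi> S A U \<phi> X \<beta> p"
    by (intro ballI, rule indep) (simp_all add: over_def)
  ultimately show ?thesis using bij lift by blast
qed

end
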